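(* In the two-slope ski rental problem with tail constraint $(\gamma,\delta)$ described in the context, suppose $\frac{\mathrm{OPT}-1}{\frac1a-1}\le\delta\le1$. Then there is a unique optimal solution $f$, and it satisfies: every point $x\in[0,1]$ is either CR tight or mass tight; $f_x=0$ for all finite $x>1$; and $f_\infty>0$.
   Context: Fix $0\le a<1$ and $(\gamma,\delta)$ with $2-a\le\gamma<1/a$, $0\le\delta\le1$. A purchase distribution $f$ is a probability distribution on $[0,\infty)\cup\{\infty\}$ (buying time; $\infty$ = never buy), with $f_t$ its mass/density at $t$. For buying time $t$ and stopping time $x>0$: $\alpha(t,x)=\frac{t+1-a+a(x-t)}{x}$ if $t\le x\le1$; $1$ if $t>x$, $x\le1$; $\frac{t+1-a+a(x-t)}{1-a+ax}$ if $t\le x$, $x>1$; $\frac{x}{1-a+ax}$ if $t>x$, $x>1$ (incl. $t=\infty$); $\alpha(t,\infty)=1$ for finite $t$, $\alpha(\infty,\infty)=1/a$. $\alpha_f(x)=\mathbb{E}_{t\sim f}\alpha(t,x)$. Bad interval $I_\gamma(x)=\{t:\alpha(t,x)>\gamma\}$; $f$ is feasible if $f(I_\gamma(x))\le\delta$ for all $x\in(0,\infty]$. $\mathrm{OPT}=\min_{f\text{ feasible}}\sup_x\alpha_f(x)$; an optimal solution is a feasible $f$ attaining it. A point $x$ is CR tight if $\alpha_f(x)=\mathrm{OPT}$ and mass tight if $f(I_\gamma(x))=\delta$.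
   Formalization: f_∞ > 0 is asserted only for a > 0: at a = 0 it is false, since α(∞,∞) = 1/a = ∞ gives infinite ratio while buying at time 1 has ratio 2. At x = 0, where α is undefined, tightness is read as the limit x → 0+. *)

theory Defs
  imports "HOL-Probability.Probability"
begin

text \<open>
  Buying times \<open>t\<close> and stopping times \<open>x\<close> both live in \<^typ>\<open>ennreal\<close>, whose elements are exactly
  \<open>[0,\<infinity>) \<union> {\<infinity>}\<close>.  Ratios are also \<^typ>\<open>ennreal\<close>-valued: they may be unbounded as \<open>x\<close> tends
  to \<open>0\<close>, and \<open>1 / ennreal a\<close> is \<open>\<infinity>\<close> for \<open>a = 0\<close>.
\<close>

definition cost_ratio :: "real \<Rightarrow> ennreal \<Rightarrow> ennreal \<Rightarrow> ennreal" where
  "cost_ratio a t x =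
    (if x = \<infinity> then (if t = \<infinity> then 1 / ennreal a else 1)
     else (let s = enn2real t; y = enn2real x in
       ennreal
        (if x \<le> 1
         then (if t \<le> x then (s + 1 - a + a * (y - s)) / y else 1)
         else (if t \<le> x then (s + 1 - a + a * (y - s)) / (1 - a + a * y)
               else y / (1 - a + a * y)))))"

lemma borel_measurable_cost_ratio [measurable]:
  "(\<lambda>t. cost_ratio a t x) \<in> borel_measurable borel"
  unfolding cost_ratio_def Let_def by measurable

definition purchase_distribution :: "ennreal measure \<Rightarrow> bool" where
  "purchase_distribution f \<longleftrightarrow> sets f = sets borel \<and> prob_space f"

definition expected_ratio :: "real \<Rightarrow> ennreal measure \<Rightarrow> ennreal \<Rightarrow> ennreal" where
  "expected_ratio a f x = (\<integral>\<^sup>+ t. cost_ratio a t x \<partial>f)"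

definition bad_interval :: "real \<Rightarrow> real \<Rightarrow> ennreal \<Rightarrow> ennreal set" where
  "bad_interval a \<gamma> x = {t. cost_ratio a t x > ennreal \<gamma>}"

lemma bad_interval_borel [measurable]: "bad_interval a \<gamma> x \<in> sets borel"
  unfolding bad_interval_def by measurable

definition feasible :: "real \<Rightarrow> real \<Rightarrow> real \<Rightarrow> ennreal measure \<Rightarrow> bool" where
  "feasible a \<gamma> \<delta> f \<longleftrightarrow>
     purchase_distribution f \<and> (\<forall>x>0. measure f (bad_interval a \<gamma> x) \<le> \<delta>)"

definition competitive_ratio :: "real \<Rightarrow> ennreal measure \<Rightarrow> ennreal" where
  "competitive_ratio a f = (SUP x\<in>{0<..}. expected_ratio a f x)"

text \<open>An infimum; that it is attained is the existence of an optimal solution.\<close>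

definition OPT :: "real \<Rightarrow> real \<Rightarrow> real \<Rightarrow> ennreal" where
  "OPT a \<gamma> \<delta> = (INF f\<in>{f. feasible a \<gamma> \<delta> f}. competitive_ratio a f)"

definition optimal :: "real \<Rightarrow> real \<Rightarrow> real \<Rightarrow> ennreal measure \<Rightarrow> bool" where
  "optimal a \<gamma> \<delta> f \<longleftrightarrow> feasible a \<gamma> \<delta> f \<and> competitive_ratio a f = OPT a \<gamma> \<delta>"

text \<open>
  The ratio is only defined for stopping times \<open>x > 0\<close> (at \<open>x = 0\<close> the first branch of
  \<^const>\<open>cost_ratio\<close> divides by zero), so tightness at the endpoint \<open>0\<close> is understood as the
  corresponding right limit.
\<close>

definition CR_tight :: "real \<Rightarrow> real \<Rightarrow> real \<Rightarrow> ennreal measure \<Rightarrow> ennreal \<Rightarrow> bool" where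
  "CR_tight a \<gamma> \<delta> f x \<longleftrightarrow>
     (if x = 0 then (expected_ratio a f \<longlongrightarrow> OPT a \<gamma> \<delta>) (at_right 0)
      else expected_ratio a f x = OPT a \<gamma> \<delta>)"

definition mass_tight :: "real \<Rightarrow> real \<Rightarrow> real \<Rightarrow> ennreal measure \<Rightarrow> ennreal \<Rightarrow> bool" where
  "mass_tight a \<gamma> \<delta> f x \<longleftrightarrow>
     (if x = 0 then ((\<lambda>y. measure f (bad_interval a \<gamma> y)) \<longlongrightarrow> \<delta>) (at_right 0)
      else measure f (bad_interval a \<gamma> x) = \<delta>)"

end

theory Submission
  imports Defs
begin

text \<open>
  Write the competitive ratio as \<open>1 + (1 - a) \<theta>\<close> and let \<open>F\<close> be the distribution function of \<open>f\<close>.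
  On \<open>[0,1]\<close> the constraints read \<open>F x \<le> \<theta> x + \<integral>\<^sub>0\<^sup>x F\<close> and \<open>F x \<le> \<delta> + F (c x - 1)\<close> with
  \<open>c = (\<gamma> - a) / (1 - a)\<close>; both right-hand sides are monotone in \<open>F\<close>, so there is a largest
  solution \<open>M\<^sub>\<theta>\<close>.  Averaging the ratio constraints at two stopping times in \<open>[1,\<infinity>)\<close> gives
  \<open>1 \<le> \<theta> (1 + a) + \<integral>\<^sub>0\<^sup>1 F\<close>, strictly if \<open>f\<close> charges \<open>(1,\<infinity>)\<close>.  Hence
  \<open>\<phi> \<theta> = \<theta> (1 + a) + \<integral>\<^sub>0\<^sup>1 M\<^sub>\<theta> \<ge> 1\<close> for every feasible ratio, and \<open>\<phi>\<close> is strictly increasing and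
  continuous.  At the \<open>\<theta>\<close> with \<open>\<phi> \<theta> = 1\<close>, the distribution given by \<open>M\<^sub>\<theta>\<close> on \<open>[0,1]\<close> and mass
  \<open>a \<theta>\<close> at \<open>\<infinity>\<close> is optimal, and equality in the estimates above makes it the only optimal one.
  The hypothesis on \<open>\<delta>\<close> says \<open>a \<theta> \<le> \<delta>\<close>, which is the tail constraint for \<open>x > 1\<close>.
\<close>

declare ennreal_plus [simp del]

section \<open>Maximal distribution functions on the unit interval\<close>

text \<open>\<open>F\<close> vanishes on \<open>(-\<infinity>,0]\<close>, so for \<open>c x < 1\<close> the last constraint is \<open>F x \<le> \<delta>\<close>, as for the bad
  interval \<open>[0,x]\<close>.  For \<open>(c - 1) x \<ge> 1\<close> the bad interval is empty.\<close>

definition subsolution :: "real \<Rightarrow> real \<Rightarrow> real \<Rightarrow> (real \<Rightarrow> real) \<Rightarrow> bool" where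
  "subsolution c \<delta> \<theta> F \<longleftrightarrow> mono F \<and> (\<forall>x\<le>0. F x = 0) \<and> (\<forall>x>1. F x = F 1) \<and>
     (\<forall>x\<in>{0..1}. F x \<le> \<theta> * x + integral {0..x} F \<and>
        ((c - 1) * x < 1 \<longrightarrow> F x \<le> \<delta> + F (c * x - 1)))"

definition max_subsolution :: "real \<Rightarrow> real \<Rightarrow> real \<Rightarrow> real \<Rightarrow> real" where
  "max_subsolution c \<delta> \<theta> x = (SUP F\<in>{F. subsolution c \<delta> \<theta> F}. F x)"

section \<open>Bounds on subsolutions and their scaling\<close>

lemma integrable_on_mono [intro]:
  fixes F :: "real \<Rightarrow> real"
  shows "mono F \<Longrightarrow> F integrable_on {u..v}"
  by (intro integrable_on_mono_on) (auto simp: mono_def mono_on_def)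

lemma integral_mono_le:
  fixes F :: "real \<Rightarrow> real"
  assumes "mono F" "u \<le> v"
  shows "integral {u..v} F \<le> (v - u) * F v"
proof -
  have "integral {u..v} F \<le> integral {u..v} (\<lambda>_. F v)"
    using assms by (intro integral_le) (auto intro: monoD[OF assms(1)])
  then show ?thesis
    using assms by simp
qed

lemma subsolutionD:
  assumes "subsolution c \<delta> \<theta> F"
  shows "mono F" "x \<le> 0 \<Longrightarrow> F x = 0" "1 \<le> x \<Longrightarrow> F x = F 1"
    "0 \<le> x \<Longrightarrow> x \<le> 1 \<Longrightarrow> F x \<le> \<theta> * x + integral {0..x} F"
    "0 \<le> x \<Longrightarrow> x \<le> 1 \<Longrightarrow> (c - 1) * x < 1 \<Longrightarrow> F x \<le> \<delta> + F (c * x - 1)"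
proof -
  note * = assms[unfolded subsolution_def]
  show "mono F"
    using * by (elim conjE)
  show "x \<le> 0 \<Longrightarrow> F x = 0"
    using * by (elim conjE) simp
  show "1 \<le> x \<Longrightarrow> F x = F 1"
    using * by (elim conjE, cases "x = 1") simp_all
  have **: "0 \<le> x \<Longrightarrow> x \<le> 1 \<Longrightarrow> x \<in> {0..1}" by simp
  show "0 \<le> x \<Longrightarrow> x \<le> 1 \<Longrightarrow> F x \<le> \<theta> * x + integral {0..x} F"
    using * ** by blast
  show "0 \<le> x \<Longrightarrow> x \<le> 1 \<Longrightarrow> (c - 1) * x < 1 \<Longrightarrow> F x \<le> \<delta> + F (c * x - 1)"
    using * ** by blast
qed

lemma subsolution_nonneg:
  assumes "subsolution c \<delta> \<theta> F"
  shows "0 \<le> F x"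
  using monoD[OF subsolutionD(1)[OF assms], of "min x 0" x] subsolutionD(2)[OF assms, of "min x 0"]
  by simp

text \<open>On all of [0,1] the estimate of the integral by \<open>F 1\<close> makes the ratio
  constraint vacuous, so the interval is halved: the constraint at 1/2 gives
  \<open>F (1/2) \<le> \<theta>\<close>, and the one at 1 then gives the bound. Being uniform in
  \<open>F\<close>, it makes the supremum \<open>max_subsolution\<close> finite.\<close>

lemma subsolution_le:
  assumes F: "subsolution c \<delta> \<theta> F"
  shows "F x \<le> 3 * \<theta>"
proof -
  note mono = subsolutionD(1)[OF F]
  have "F (1/2) \<le> \<theta> * (1/2) + integral {0..1/2} F"
    by (rule subsolutionD(4)[OF F]) auto
  then have half: "F (1/2) \<le> \<theta>"
    using integral_mono_le[OF mono, of 0 "1/2"] by simp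
  have "F 1 \<le> \<theta> * 1 + integral {0..1} F"
    by (rule subsolutionD(4)[OF F]) auto
  also have "integral {0..1} F = integral {0..1/2} F + integral {1/2..1} F"
    by (rule Henstock_Kurzweil_Integration.integral_combine[symmetric]) (use mono in auto)
  finally have "F 1 \<le> 3 * \<theta>"
    using integral_mono_le[OF mono, of 0 "1/2"] integral_mono_le[OF mono, of "1/2" 1] half by simp
  then show ?thesis
    using subsolutionD(3)[OF F, of x] monoD[OF mono, of x 1] by (cases "x \<le> 1") auto
qed

text \<open>The ratio constraint is homogeneous in the pair of \<open>\<theta>\<close> and
  \<open>F\<close>, and the mass constraint only gains slack because
  \<open>l * \<delta> \<le> \<delta>\<close>.\<close>

lemma subsolution_scale:
  assumes F: "subsolution c \<delta> \<theta> F" and "0 \<le> \<delta>" "0 \<le> l" "l \<le> 1"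
  shows "subsolution c \<delta> (l * \<theta>) (\<lambda>x. l * F x)"
  unfolding subsolution_def
proof (intro conjI allI impI ballI)
  show "mono (\<lambda>x. l * F x)"
    using subsolutionD(1)[OF F] \<open>0 \<le> l\<close> by (auto simp: mono_def intro: mult_left_mono)
next
  fix x :: real assume x: "x \<in> {0..1}"
  have "l * F x \<le> l * (\<theta> * x + integral {0..x} F)"
    using x \<open>0 \<le> l\<close> by (intro mult_left_mono subsolutionD(4)[OF F]) auto
  then show "l * F x \<le> l * \<theta> * x + integral {0..x} (\<lambda>x. l * F x)"
    by (simp add: algebra_simps)
  assume "(c - 1) * x < 1"
  then have "l * F x \<le> l * (\<delta> + F (c * x - 1))"
    using x \<open>0 \<le> l\<close> by (intro mult_left_mono subsolutionD(5)[OF F]) auto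
  also have "\<dots> \<le> \<delta> + l * F (c * x - 1)"
    using assms by (simp add: mult_left_le_one_le distrib_left)
  finally show "l * F x \<le> \<delta> + l * F (c * x - 1)" .
next
  fix x :: real assume "1 < x"
  then show "l * F x = l * F 1"
    using subsolutionD(3)[OF F, of x] by simp
qed (use subsolutionD(2)[OF F] in auto)

section \<open>The maximal subsolution: tightness and right continuity\<close>

locale maximal_subsolution =
  fixes c \<delta> :: real
  assumes c: "2 \<le> c" and \<delta>: "0 \<le> \<delta>"
begin

abbreviation "M \<equiv> max_subsolution c \<delta>"

lemma subsolution_zero: "0 \<le> \<theta> \<Longrightarrow> subsolution c \<delta> \<theta> (\<lambda>_. 0)"
  unfolding subsolution_def using \<delta> by (auto simp: mono_def)

lemma subsolution_le_M: "subsolution c \<delta> \<theta> F \<Longrightarrow> F x \<le> M \<theta> x"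
  unfolding max_subsolution_def
  by (rule cSUP_upper) (auto intro!: bdd_aboveI[of _ "3 * \<theta>"] dest: subsolution_le)

lemma M_least:
  "0 \<le> \<theta> \<Longrightarrow> (\<And>F. subsolution c \<delta> \<theta> F \<Longrightarrow> F x \<le> b) \<Longrightarrow> M \<theta> x \<le> b"
  unfolding max_subsolution_def by (rule cSUP_least) (use subsolution_zero in auto)

text \<open>Each constraint bounds \<open>F x\<close> by an expression monotone in \<open>F\<close>.
  Enlarging \<open>F\<close> to \<open>M \<theta>\<close> on the right and then taking the supremum
  on the left carries it over to \<open>M \<theta>\<close>.\<close>

lemma subsolution_M:
  assumes "0 \<le> \<theta>"
  shows "subsolution c \<delta> \<theta> (M \<theta>)"
proof -
  have mono: "mono (M \<theta>)"
  proof (intro monoI M_least assms)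
    fix x y :: real and F assume "x \<le> y" and F: "subsolution c \<delta> \<theta> F"
    have "F x \<le> F y"
      using subsolutionD(1)[OF F] \<open>x \<le> y\<close> by (rule monoD)
    also have "\<dots> \<le> M \<theta> y"
      using F by (rule subsolution_le_M)
    finally show "F x \<le> M \<theta> y" .
  qed
  have eq: "M \<theta> x = M \<theta> y" if "\<And>F. subsolution c \<delta> \<theta> F \<Longrightarrow> F x = F y" for x y
    unfolding max_subsolution_def by (rule SUP_cong) (use that in auto)
  show ?thesis
    unfolding subsolution_def
  proof (intro conjI allI impI ballI mono)
    fix x :: real assume "x \<le> 0"
    then have "M \<theta> x \<le> 0"
      by (intro M_least assms) (simp add: subsolutionD(2)[where x = x])
    then show "M \<theta> x = 0"
      using subsolution_le_M[OF subsolution_zero, of \<theta> x] assms by simp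
  next
    fix x :: real assume "1 < x"
    then show "M \<theta> x = M \<theta> 1"
      by (intro eq) (simp add: subsolutionD(3)[where x = x])
  next
    fix x :: real assume x: "x \<in> {0..1}"
    show "M \<theta> x \<le> \<theta> * x + integral {0..x} (M \<theta>)"
    proof (rule M_least[OF assms])
      fix F assume F: "subsolution c \<delta> \<theta> F"
      have "F x \<le> \<theta> * x + integral {0..x} F"
        using x by (intro subsolutionD(4)[OF F]) auto
      also have "integral {0..x} F \<le> integral {0..x} (M \<theta>)"
        by (intro integral_le integrable_on_mono mono subsolutionD(1)[OF F] subsolution_le_M[OF F])
      finally show "F x \<le> \<theta> * x + integral {0..x} (M \<theta>)" by simp
    qed
    assume "(c - 1) * x < 1"
    show "M \<theta> x \<le> \<delta> + M \<theta> (c * x - 1)"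
    proof (rule M_least[OF assms])
      fix F assume F: "subsolution c \<delta> \<theta> F"
      have "F x \<le> \<delta> + F (c * x - 1)"
        using x \<open>(c - 1) * x < 1\<close> by (intro subsolutionD(5)[OF F]) auto
      with subsolution_le_M[OF F, of "c * x - 1"] show "F x \<le> \<delta> + M \<theta> (c * x - 1)"
        by simp
    qed
  qed
qed

lemmas M_mono = subsolutionD(1)[OF subsolution_M]
lemmas M_zero = subsolutionD(2)[OF subsolution_M]
lemmas M_const = subsolutionD(3)[OF subsolution_M]
lemmas M_nonneg = subsolution_nonneg[OF subsolution_M]
lemmas M_le = subsolution_le[OF subsolution_M]
lemmas M_integral = subsolutionD(4)[OF subsolution_M]
lemmas M_mass = subsolutionD(5)[OF subsolution_M]

lemma M_mono_\<theta>:
  assumes "0 \<le> \<theta>" "\<theta> \<le> \<theta>'"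
  shows "M \<theta> x \<le> M \<theta>' x"
proof (rule subsolution_le_M)
  note S = subsolution_M[OF assms(1)]
  show "subsolution c \<delta> \<theta>' (M \<theta>)"
    unfolding subsolution_def
  proof (intro conjI allI impI ballI subsolutionD[OF S])
    fix x :: real assume x: "x \<in> {0..1}"
    have "M \<theta> x \<le> \<theta> * x + integral {0..x} (M \<theta>)"
      using x by (intro subsolutionD(4)[OF S]) auto
    also have "\<theta> * x \<le> \<theta>' * x"
      using assms x by (intro mult_right_mono) auto
    finally show "M \<theta> x \<le> \<theta>' * x + integral {0..x} (M \<theta>)" by simp
  qed auto
qed

lemma integral_M_nonneg: "0 \<le> \<theta> \<Longrightarrow> 0 \<le> integral {u..v} (M \<theta>)"
  by (intro integral_nonneg integrable_on_mono M_mono M_nonneg)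

lemma integral_M_increment:
  assumes "0 \<le> \<theta>" "0 \<le> x" "x \<le> y"
  shows "integral {0..y} (M \<theta>) \<le> integral {0..x} (M \<theta>) + 3 * \<theta> * (y - x)"
    and "integral {0..x} (M \<theta>) \<le> integral {0..y} (M \<theta>)"
proof -
  have eq: "integral {0..y} (M \<theta>) = integral {0..x} (M \<theta>) + integral {x..y} (M \<theta>)"
    by (rule Henstock_Kurzweil_Integration.integral_combine[symmetric])
       (use assms M_mono in auto)
  have "integral {x..y} (M \<theta>) \<le> (y - x) * M \<theta> y"
    using assms by (intro integral_mono_le M_mono)
  also have "\<dots> \<le> (y - x) * (3 * \<theta>)"
    using assms by (intro mult_left_mono M_le) auto
  finally show "integral {0..y} (M \<theta>) \<le> integral {0..x} (M \<theta>) + 3 * \<theta> * (y - x)"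
    using eq by (simp add: mult.commute)
  show "integral {0..x} (M \<theta>) \<le> integral {0..y} (M \<theta>)"
    using eq integral_M_nonneg[OF assms(1), of x y] by simp
qed

text \<open>The right-hand side of the constraints, applied to the maximal subsolution, is again a
  subsolution.  By maximality one of the constraints is an equality at every point.\<close>

lemma M_tight:
  assumes \<theta>: "0 \<le> \<theta>" and x: "0 \<le> x" "x \<le> 1"
  shows "M \<theta> x = \<theta> * x + integral {0..x} (M \<theta>) \<or>
    (c - 1) * x < 1 \<and> M \<theta> x = \<delta> + M \<theta> (c * x - 1)"
proof -
  define u where "u = (\<lambda>x. \<theta> * x + integral {0..x} (M \<theta>))"
  define T where "T = (\<lambda>x. if (c - 1) * x < 1 then min (u x) (\<delta> + M \<theta> (c * x - 1)) else u x)"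
  \<comment> \<open>\<open>G\<close> extends \<open>T\<close> from [0,1] to the real line in the
    shape that \<open>subsolution\<close> prescribes: zero on the left, constant on the
    right.\<close>
  define G where "G = (\<lambda>x. if x \<le> 0 then 0 else T (min x 1))"
  have u_mono: "u x \<le> u y" if "0 \<le> x" "x \<le> y" for x y
    unfolding u_def using \<theta> that by (intro add_mono mult_left_mono integral_M_increment)
  \<comment> \<open>Once \<open>(c - 1) * x\<close> reaches 1 the mass bound is dropped from the
    minimum, which can only raise \<open>T\<close>, so the case distinction preserves
    monotonicity.\<close>
  have T_mono: "T x \<le> T y" if "0 \<le> x" "x \<le> y" for x y
  proof -
    have "c * x \<le> c * y" "(c - 1) * x \<le> (c - 1) * y"
      using c that by (auto intro!: mult_left_mono)
    then show ?thesis
      unfolding T_def using u_mono[OF that] monoD[OF M_mono[OF \<theta>], of "c * x - 1" "c * y - 1"]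
      by auto
  qed
  have T_nonneg: "0 \<le> T x" if "0 \<le> x" for x
    using that \<delta> \<theta> M_nonneg[OF \<theta>] integral_M_nonneg[OF \<theta>] by (auto simp: T_def u_def)
  have T0: "T 0 = 0"
    using \<delta> M_zero[OF \<theta>, of "-1"] by (simp add: T_def u_def)
  have GT: "G x = T x" if "0 \<le> x" "x \<le> 1" for x
    using that T0 by (cases "x = 0") (auto simp: G_def)
  have M_le_T: "M \<theta> x \<le> T x" if "0 \<le> x" "x \<le> 1" for x
    using M_integral[OF \<theta> that] M_mass[OF \<theta> that] by (auto simp: T_def u_def)
  have M_le_G: "M \<theta> x \<le> G x" for x
    using M_le_T[of "min x 1"] M_zero[OF \<theta>, of x] M_const[OF \<theta>, of x] T0
    by (cases "x \<le> 0"; cases "x \<le> 1") (auto simp: G_def min_def)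
  have G_mono: "mono G"
  proof (rule monoI)
    fix x y :: real assume "x \<le> y"
    then show "G x \<le> G y"
      using T_mono[of "min x 1" "min y 1"] T_nonneg[of "min y 1"] by (auto simp: G_def)
  qed
  have "subsolution c \<delta> \<theta> G"
    unfolding subsolution_def
  proof (intro conjI allI impI ballI G_mono)
    fix x :: real assume x: "x \<in> {0..1}"
    have "G x \<le> u x"
      using x by (auto simp: GT T_def)
    also have "\<dots> \<le> \<theta> * x + integral {0..x} G"
      unfolding u_def using M_le_G
      by (intro add_left_mono integral_le integrable_on_mono G_mono M_mono \<theta>) auto
    finally show "G x \<le> \<theta> * x + integral {0..x} G" .
    assume "(c - 1) * x < 1"
    then show "G x \<le> \<delta> + G (c * x - 1)"
      using x M_le_G[of "c * x - 1"] by (auto simp: GT T_def)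
  qed (auto simp: G_def)
  then have "G x \<le> M \<theta> x"
    by (rule subsolution_le_M)
  with x M_le_T[OF x] have "M \<theta> x = T x"
    by (simp add: GT)
  then show ?thesis
    by (auto simp: T_def u_def min_def split: if_splits)
qed

text \<open>At 1 the mass alternative of \<open>M_tight\<close> is excluded, since
  \<open>c - 1 \<ge> 1\<close>.\<close>

lemma M_1:
  assumes "0 \<le> \<theta>"
  shows "M \<theta> 1 = \<theta> + integral {0..1} (M \<theta>)"
  using M_tight[OF assms, of 1] c by auto

text \<open>The right limit \<open>G\<close> of \<open>M \<theta>\<close> satisfies the same
  constraints, so it lies below \<open>M \<theta>\<close> by maximality. This makes
  \<open>M \<theta>\<close> usable as a distribution function.\<close>

lemma M_right_continuous:
  assumes \<theta>: "0 \<le> \<theta>"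
  shows "continuous (at_right x) (M \<theta>)"
proof -
  define G where "G = (\<lambda>x. INF y\<in>{x<..}. M \<theta> y)"
  have bdd: "bdd_below (M \<theta> ` A)" for A
    using M_nonneg[OF \<theta>] by (intro bdd_belowI[of _ 0]) auto
  have G_le: "G x \<le> M \<theta> y" if "x < y" for x y
    unfolding G_def using that bdd by (intro cINF_lower) auto
  have G_ge: "b \<le> G x" if "\<And>y. x < y \<Longrightarrow> b \<le> M \<theta> y" for b x
    unfolding G_def using that by (intro cINF_greatest) auto
  have M_le_G: "M \<theta> x \<le> G x" for x
    by (intro G_ge monoD[OF M_mono[OF \<theta>]]) simp
  have G_mono: "mono G"
    by (intro monoI G_ge G_le) simp
  have G_le_lim: "G x \<le> b" if "\<And>e. e > 0 \<Longrightarrow> \<exists>y>x. M \<theta> y \<le> b + e" for b x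
  proof (rule field_le_epsilon)
    fix e :: real assume "e > 0"
    then show "G x \<le> b + e"
      using that[of e] G_le[of x] by force
  qed
  have G_const: "G x = M \<theta> 1" if "1 \<le> x" for x
    using that M_const[OF \<theta>, of x] M_const[OF \<theta>, of "x + 1"] G_le[of x "x + 1"] M_le_G[of x]
    by linarith
  have G_integral: "G x \<le> \<theta> * x + integral {0..x} G" if x: "0 \<le> x" "x \<le> 1" for x
  proof -
    have "G x \<le> \<theta> * x + integral {0..x} (M \<theta>)"
    \<comment> \<open>To the right of 1 there is no ratio constraint to take limits in; there
      \<open>M \<theta>\<close> is constant and \<open>M_1\<close> gives the bound.\<close>
    proof (cases "x = 1")
      case True
      then show ?thesis using M_1[OF \<theta>] by (simp add: G_const)
    next
      case False
      show ?thesis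
      proof (rule G_le_lim)
        fix e :: real assume "e > 0"
        \<comment> \<open>Moving from \<open>x\<close> to \<open>y\<close> raises the linear term by
          \<open>\<theta> * (y - x)\<close> and the integral by at most three times that, so
          \<open>4 * \<theta> * (y - x) \<le> e\<close> suffices; the added 1 keeps the denominator
          positive.\<close>
        define y where "y = min 1 (x + e / (4 * \<theta> + 1))"
        have y: "x < y" "y \<le> 1" "y - x \<le> e / (4 * \<theta> + 1)"
          using \<open>e > 0\<close> x False \<theta> by (auto simp: y_def)
        have "(4 * \<theta> + 1) * (y - x) \<le> e"
          using y(3) \<theta> by (simp add: pos_le_divide_eq mult.commute)
        have "M \<theta> y \<le> \<theta> * y + integral {0..y} (M \<theta>)"
          using x y by (intro M_integral \<theta>) auto
        also have "integral {0..y} (M \<theta>) \<le> integral {0..x} (M \<theta>) + 3 * \<theta> * (y - x)"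
          using x y by (intro integral_M_increment \<theta>) auto
        finally have "M \<theta> y \<le> \<theta> * x + integral {0..x} (M \<theta>) + e"
          using y(1) \<open>(4 * \<theta> + 1) * (y - x) \<le> e\<close> by (simp add: algebra_simps)
        then show "\<exists>y>x. M \<theta> y \<le> \<theta> * x + integral {0..x} (M \<theta>) + e"
          using y by blast
      qed
    qed
    also have "\<dots> \<le> \<theta> * x + integral {0..x} G"
      using M_le_G by (intro add_left_mono integral_le integrable_on_mono G_mono M_mono \<theta>)
    finally show ?thesis .
  qed
  have "subsolution c \<delta> \<theta> G"
    unfolding subsolution_def
  proof (intro conjI allI impI ballI G_mono)
    have G0: "G 0 \<le> 0"
      using G_integral[of 0] by simp
    fix x :: real assume "x \<le> 0"
    then show "G x = 0"
      using monoD[OF G_mono, of x 0] G0 M_le_G[of x] M_nonneg[OF \<theta>, of x] by linarith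
  next
    fix x :: real assume "1 < x"
    then show "G x = G 1" by (simp add: G_const)
  next
    fix x :: real assume x: "x \<in> {0..1}"
    show "G x \<le> \<theta> * x + integral {0..x} G"
      using x by (intro G_integral) auto
    assume cx: "(c - 1) * x < 1"
    have "x < 1"
      using cx x c mult_right_mono[of 1 "c - 1" x] by (cases "x = 1") auto
    have x_less: "x < 1 / (c - 1)"
      using cx c by (simp add: pos_less_divide_eq mult.commute)
    have "G x - \<delta> \<le> G (c * x - 1)"
    proof (rule G_ge)
      fix z assume z: "c * x - 1 < z"
      \<comment> \<open>\<open>y\<close> must exceed \<open>x\<close> and satisfy
        \<open>y \<le> 1\<close>, \<open>c * y - 1 \<le> z\<close> and
        \<open>(c - 1) * y < 1\<close>; the midpoint of \<open>x\<close> and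
        \<open>1 / (c - 1)\<close> secures the last, strict inequality.\<close>
      define y where "y = Min {1, (z + 1) / c, (x + 1 / (c - 1)) / 2}"
      have "x < y"
        unfolding y_def using z cx c \<open>x < 1\<close> by (auto simp: field_simps)
      have "y \<le> 1" "y \<le> (z + 1) / c" "y \<le> (x + 1 / (c - 1)) / 2"
        unfolding y_def by (intro Min_le; simp)+
      moreover have "(x + 1 / (c - 1)) / 2 < 1 / (c - 1)"
        using x_less by simp
      ultimately have y: "y \<le> 1" "c * y - 1 \<le> z" "y < 1 / (c - 1)"
        using c by (auto simp: pos_le_divide_eq mult.commute)
      then have cy: "(c - 1) * y < 1"
        using c by (simp add: pos_less_divide_eq mult.commute)
      have "G x \<le> M \<theta> y"
        using \<open>x < y\<close> by (rule G_le)
      also have "\<dots> \<le> \<delta> + M \<theta> (c * y - 1)"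
        using x y cy \<open>x < y\<close> by (intro M_mass \<theta>) auto
      also have "\<dots> \<le> \<delta> + M \<theta> z"
        using y by (intro add_left_mono monoD[OF M_mono[OF \<theta>]])
      finally show "G x - \<delta> \<le> M \<theta> z" by simp
    qed
    then show "G x \<le> \<delta> + G (c * x - 1)" by simp
  qed
  then have "G x \<le> M \<theta> x" for x
    by (rule subsolution_le_M)
  then have "G x = M \<theta> x"
    using M_le_G by (intro antisym)
  show ?thesis
  proof (subst continuous_at_right_real_increasing)
    show "M \<theta> x \<le> M \<theta> y" if "x \<le> y" for x y
      using M_mono[OF \<theta>] that by (rule monoD)
    show "\<forall>e>0. \<exists>d>0. M \<theta> (x + d) - M \<theta> x < e"
    proof (intro allI impI)
      fix e :: real assume "e > 0"
      then have "(INF y\<in>{x<..}. M \<theta> y) < M \<theta> x + e"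
        using \<open>G x = M \<theta> x\<close> by (simp add: G_def)
      then obtain y where "x < y" "M \<theta> y < M \<theta> x + e"
        by (subst (asm) cINF_less_iff) (auto intro: bdd)
      then show "\<exists>d>0. M \<theta> (x + d) - M \<theta> x < e"
        by (intro exI[of _ "y - x"]) auto
    qed
  qed
qed

section \<open>The function \<open>\<phi>\<close> and its level 1\<close>

lemma M_scale:
  assumes "0 \<le> \<theta>" "0 \<le> l" "l \<le> 1"
  shows "l * M \<theta> x \<le> M (l * \<theta>) x"
  by (rule subsolution_le_M[OF subsolution_scale[OF subsolution_M]]) (use assms \<delta> in auto)

definition \<phi> :: "real \<Rightarrow> real \<Rightarrow> real" where
  "\<phi> a \<theta> = \<theta> * (1 + a) + integral {0..1} (M \<theta>)"

lemma \<phi>_strict_mono: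
  assumes "0 \<le> a" "0 \<le> \<theta>" "\<theta> < \<theta>'"
  shows "\<phi> a \<theta> < \<phi> a \<theta>'"
proof -
  have "integral {0..1} (M \<theta>) \<le> integral {0..1} (M \<theta>')"
    by (intro integral_le integrable_on_mono M_mono M_mono_\<theta>) (use assms in auto)
  moreover have "\<theta> * (1 + a) < \<theta>' * (1 + a)"
    using assms by simp
  ultimately show ?thesis
    by (simp add: \<phi>_def)
qed

lemma \<phi>_le:
  assumes "0 \<le> \<theta>"
  shows "\<phi> a \<theta> \<le> \<theta> * (4 + a)"
  using integral_M_increment(1)[OF assms, of 0 1] by (simp add: \<phi>_def algebra_simps)

lemma \<phi>_scale:
  assumes "0 \<le> \<theta>" "0 \<le> l" "l \<le> 1"
  shows "l * \<phi> a \<theta> \<le> \<phi> a (l * \<theta>)"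
proof -
  have "integral {0..1} (\<lambda>x. l * M \<theta> x) \<le> integral {0..1} (M (l * \<theta>))"
    by (intro integral_le integrable_on_mult_right integrable_on_mono M_mono M_scale)
       (use assms in auto)
  then show ?thesis
    by (simp add: \<phi>_def algebra_simps)
qed

text \<open>Scaling by \<open>s / t\<close> gives
  \<open>\<phi> a s \<ge> (s / t) * \<phi> a t\<close>, so the increase is at most
  \<open>\<phi> a t * (1 - s / t)\<close>, and \<open>\<phi>_le\<close> bounds the first factor
  linearly in \<open>t\<close>.\<close>

lemma \<phi>_lipschitz:
  assumes "0 \<le> a" "0 \<le> s" "s \<le> t"
  shows "\<phi> a t - \<phi> a s \<le> (4 + a) * (t - s)"
proof (cases "t = 0")
  case True
  then show ?thesis using assms by simp
next
  case False
  then have t: "t > 0" using assms by simp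
  have "s / t * \<phi> a t \<le> \<phi> a (s / t * t)"
    using assms t by (intro \<phi>_scale) auto
  then have "\<phi> a t - \<phi> a s \<le> \<phi> a t * (1 - s / t)"
    using t by (simp add: algebra_simps)
  also have "\<dots> \<le> (t * (4 + a)) * (1 - s / t)"
    using assms t by (intro mult_right_mono \<phi>_le) auto
  also have "\<dots> = (4 + a) * (t - s)"
    using t by (simp add: field_simps)
  finally show ?thesis .
qed

text \<open>Intermediate value theorem on [0,1]: \<open>\<phi> a\<close> is at most 0 at 0, and at 1
  the linear term \<open>1 + a\<close> alone reaches 1.\<close>

lemma ex_\<phi>_eq_1:
  assumes "0 \<le> a"
  obtains \<theta> where "0 < \<theta>" "\<phi> a \<theta> = 1"
proof -
  have "continuous_on {0..1} (\<phi> a)"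
  proof (rule lipschitz_on_continuous_on)
    show "(4 + a)-lipschitz_on {0..1} (\<phi> a)"
    proof (rule lipschitz_onI)
      fix s t :: real assume st: "s \<in> {0..1}" "t \<in> {0..1}"
      have "\<phi> a s \<le> \<phi> a t" if "0 \<le> s" "s \<le> t" for s t
        using \<phi>_strict_mono[OF assms, of s t] that by (cases "s = t") auto
      then show "dist (\<phi> a s) (\<phi> a t) \<le> (4 + a) * dist s t"
        using st \<phi>_lipschitz[OF assms, of s t] \<phi>_lipschitz[OF assms, of t s]
        by (cases "s \<le> t") (auto simp: dist_real_def)
    qed (use assms in auto)
  qed
  moreover have "\<phi> a 0 \<le> 1" "\<phi> a 1 \<ge> 1"
    using \<phi>_le[of 0 a] integral_M_nonneg[of 1 0 1] assms by (auto simp: \<phi>_def)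
  ultimately obtain \<theta> where \<theta>: "0 \<le> \<theta>" "\<phi> a \<theta> = 1"
    using IVT'[of "\<phi> a" 0 1 1] by auto
  moreover have "\<theta> \<noteq> 0"
    using \<phi>_le[of 0 a] \<theta> by auto
  ultimately show ?thesis
    using that[of \<theta>] by auto
qed

text \<open>If \<open>F x < M \<theta> x\<close>, right continuity of \<open>F\<close> keeps
  \<open>F\<close> below \<open>M \<theta> x\<close> on a whole interval \<open>[x, y]\<close>,
  where \<open>M \<theta>\<close> is at least that value. The integral of \<open>F\<close> is then
  strictly smaller.\<close>

lemma eq_M_if_integral_eq:
  assumes \<theta>: "0 \<le> \<theta>" and F: "mono F" "\<And>x. F x \<le> M \<theta> x"
    and cont: "\<And>x. 0 \<le> x \<Longrightarrow> x < 1 \<Longrightarrow> continuous (at_right x) F"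
    and int: "integral {0..1} (M \<theta>) \<le> integral {0..1} F"
    and x: "0 \<le> x" "x < 1"
  shows "F x = M \<theta> x"
proof (rule ccontr)
  assume "F x \<noteq> M \<theta> x"
  then have "0 < M \<theta> x - F x"
    using F(2)[of x] by simp
  moreover have "\<forall>e>0. \<exists>d>0. F (x + d) - F x < e"
    using cont[OF x] monoD[OF F(1)] by (subst (asm) continuous_at_right_real_increasing)
  ultimately obtain d where d: "d > 0" "F (x + d) - F x < M \<theta> x - F x"
    by blast
  define y where "y = min 1 (x + d)"
  have y: "x < y" "y \<le> 1" "F y < M \<theta> x"
    using d x monoD[OF F(1), of y "x + d"] by (auto simp: y_def)
  have split: "integral {0..1} g = integral {0..x} g + integral {x..y} g + integral {y..1} g"
    if "mono g" for g :: "real \<Rightarrow> real"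
  proof -
    have "integral {0..x} g + integral {x..y} g = integral {0..y} g"
      using x y that by (intro Henstock_Kurzweil_Integration.integral_combine integrable_on_mono) auto
    moreover have "integral {0..y} g + integral {y..1} g = integral {0..1} g"
      using x y that by (intro Henstock_Kurzweil_Integration.integral_combine integrable_on_mono) auto
    ultimately show ?thesis by simp
  qed
  have le: "integral {u..v} F \<le> integral {u..v} (M \<theta>)" for u v
    by (intro integral_le integrable_on_mono F M_mono \<theta>)
  have "integral {x..y} F \<le> (y - x) * F y"
    using y F by (intro integral_mono_le) auto
  also have "\<dots> < (y - x) * M \<theta> x"
    using y by simp
  also have "\<dots> = integral {x..y} (\<lambda>_. M \<theta> x)"
    using y by simp
  also have "\<dots> \<le> integral {x..y} (M \<theta>)"
    by (intro integral_le integrable_on_mono M_mono \<theta>) (auto intro: monoD[OF M_mono[OF \<theta>]])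
  finally show False
    using int split[OF F(1)] split[OF M_mono[OF \<theta>]] le[of 0 x] le[of y 1] by linarith
qed

end

section \<open>Purchase distributions\<close>

locale purchase = prob_space f for f :: "ennreal measure" +
  assumes sets_f [measurable_cong]: "sets f = sets borel"

lemma purchase_iff: "purchase f \<longleftrightarrow> purchase_distribution f"
  unfolding purchase_def purchase_axioms_def purchase_distribution_def by auto

text \<open>Frozen at 1 so as to have the shape of a \<open>subsolution\<close>. The value at 0 is
  the atom there; that it vanishes is a consequence of the ratio bound.\<close>

definition cdf_upto_1 :: "ennreal measure \<Rightarrow> real \<Rightarrow> real" where
  "cdf_upto_1 f x = (if x < 0 then 0 else measure f {..ennreal (min x 1)})"

section \<open>Expected ratios in terms of the distribution function\<close>

text \<open>Splitting off 1 and the factor \<open>1 - a\<close> matches the form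
  \<open>1 + (1 - a) * \<theta>\<close> of the ratio bound and leaves an excess that is easy to
  integrate.\<close>

lemma cost_ratio_le_1:
  assumes "0 < r" "r \<le> 1"
  shows "cost_ratio a t (ennreal r) =
    ennreal (1 + (1 - a) / r * (if t \<le> ennreal r then enn2real t + 1 - r else 0))"
proof -
  have "(s + 1 - a + a * (r - s)) / r = 1 + (1 - a) / r * (s + 1 - r)" for s
    using assms by (simp add: field_simps)
  then show ?thesis
    using assms by (simp add: cost_ratio_def Let_def)
qed

lemma cost_ratio_gt_1:
  assumes "0 \<le> a" "a < 1" "1 < r"
  shows "cost_ratio a t (ennreal r) =
    ennreal (1 + (1 - a) / (1 - a + a * r) * (if t \<le> ennreal r then enn2real t else r - 1))"
proof -
  have pos: "0 < 1 - a + a * r"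
    using assms by (intro add_pos_nonneg) auto
  have "(s + 1 - a + a * (r - s)) / (1 - a + a * r) = 1 + (1 - a) / (1 - a + a * r) * s" for s
    using pos by (simp add: divide_simps) (simp add: algebra_simps)
  moreover have "r / (1 - a + a * r) = 1 + (1 - a) / (1 - a + a * r) * (r - 1)"
    using pos by (simp add: divide_simps) (simp add: algebra_simps)
  ultimately show ?thesis
    using assms by (simp add: cost_ratio_def Let_def)
qed

lemma enn2real_le: "t \<le> ennreal r \<Longrightarrow> 0 \<le> r \<Longrightarrow> enn2real t \<le> r"
  using enn2real_mono[of t "ennreal r"] by simp

lemma le_ennreal_iff: "0 \<le> r \<Longrightarrow> t \<le> ennreal r \<longleftrightarrow> t < \<infinity> \<and> enn2real t \<le> r"
  by (cases t) (auto simp: top_unique)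

lemma ennreal_top_or_real:
  fixes x :: ennreal
  obtains "x = \<infinity>" | r where "0 \<le> r" "x = ennreal r"
  by (cases x) auto

context purchase
begin

abbreviation "F \<equiv> cdf_upto_1 f"

lemma space_f [simp]: "space f = UNIV"
  using sets_eq_imp_space_eq[OF sets_f] by simp

lemma in_sets_f [simp]: "A \<in> sets f \<longleftrightarrow> A \<in> sets borel"
  by (simp add: sets_f)

lemma prob_UNIV [simp]: "measure f UNIV = 1"
  using prob_space by simp

lemma cdf_mono: "mono F"
proof (rule monoI)
  fix x y :: real assume "x \<le> y"
  then show "F x \<le> F y"
    unfolding cdf_upto_1_def by (auto intro!: finite_measure_mono ennreal_leI)
qed

lemma cdf_eq: "0 \<le> x \<Longrightarrow> x \<le> 1 \<Longrightarrow> F x = measure f {..ennreal x}"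
  by (simp add: cdf_upto_1_def)

lemma cdf_right_continuous:
  assumes "0 \<le> x" "x < 1"
  shows "continuous (at_right x) F"
proof -
  \<comment> \<open>Collapsing all buying times beyond 1 to the real number 2 leaves the
    distribution function on [0,1] unchanged and makes the theory of real distributions
    applicable.\<close>
  define g where "g = (\<lambda>t::ennreal. if t \<le> 1 then enn2real t else 2)"
  have [measurable]: "g \<in> borel_measurable borel"
    unfolding g_def by measurable
  interpret D: real_distribution "distr f borel g"
    by (rule real_distribution_distr) measurable
  have g_le: "g t \<le> y \<longleftrightarrow> t \<le> ennreal y" if "0 \<le> y" "y \<le> 1" for t y
  proof -
    have "ennreal y \<le> 1" using that by simp
    with that show ?thesis
      using order_trans[of t "ennreal y" 1] by (cases t) (auto simp: g_def top_unique)
  qed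
  have eq: "cdf (distr f borel g) y = F y" if "0 \<le> y" "y \<le> 1" for y
    unfolding cdf_def cdf_eq[OF that]
    by (subst measure_distr) (auto simp: g_le[OF that] vimage_def atMost_def)
  have "\<forall>e>0. \<exists>d>0. cdf (distr f borel g) (x + d) - cdf (distr f borel g) x < e"
    using D.cdf_is_right_cont[of x]
    by (subst (asm) continuous_at_right_real_increasing) (auto intro: D.cdf_nondecreasing)
  have "\<exists>d>0. F (x + d) - F x < e" if "e > 0" for e
  proof -
    obtain d where d: "d > 0" "cdf (distr f borel g) (x + d) - cdf (distr f borel g) x < e"
      using \<open>e > 0\<close> \<open>\<forall>e>0. \<exists>d>0. _\<close> by blast
    \<comment> \<open>This keeps \<open>x + d'\<close> in [0,1], where both distribution functions
      agree.\<close>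
    define d' where "d' = min d (1 - x)"
    have "cdf (distr f borel g) (x + d') \<le> cdf (distr f borel g) (x + d)"
      by (intro D.cdf_nondecreasing) (simp add: d'_def)
    then show ?thesis
      using d assms eq[of "x + d'"] eq[of x] by (intro exI[of _ d']) (auto simp: d'_def)
  qed
  then show ?thesis
    by (subst continuous_at_right_real_increasing) (auto intro: monoD[OF cdf_mono])
qed

lemma integrable_le_1:
  assumes "0 \<le> x"
  shows "integrable f (\<lambda>t. if t \<le> ennreal x then x - enn2real t else 0)"
  by (rule integrable_const_bound[of _ x])
     (use assms in \<open>auto intro!: AE_I2 simp: abs_le_iff add_increasing dest: enn2real_le\<close>)

text \<open>Fubini: the probability of \<open>t \<le> u\<close>, integrated over \<open>u\<close> in
  \<open>[0, x]\<close>, is the expected length of \<open>[t, x]\<close>.\<close>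

lemma integral_cdf:
  assumes "0 \<le> x" "x \<le> 1"
  shows "integral {0..x} F = (\<integral>t. (if t \<le> ennreal x then x - enn2real t else 0) \<partial>f)"
proof -
  interpret P: pair_sigma_finite f lborel ..
  define I :: "ennreal \<times> real \<Rightarrow> ennreal" where
    "I = (\<lambda>(t, u). if 0 \<le> u \<and> u \<le> x \<and> t \<le> ennreal u then 1 else 0)"
  have [measurable]: "I \<in> borel_measurable (f \<Otimes>\<^sub>M lborel)"
    unfolding I_def by measurable
  have F_nonneg: "0 \<le> F u" for u
    by (simp add: cdf_upto_1_def)
  have "ennreal (integral {0..x} F) = (\<integral>\<^sup>+u. ennreal (F u) * indicator {0..x} u \<partial>lborel)"
    by (rule nn_integral_has_integral_lebesgue'[symmetric])
       (auto simp: F_nonneg intro!: integrable_integral integrable_on_mono cdf_mono)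
  also have "\<dots> = (\<integral>\<^sup>+u. \<integral>\<^sup>+t. I (t, u) \<partial>f \<partial>lborel)"
  proof (rule nn_integral_cong)
    fix u :: real
    have "(\<integral>\<^sup>+t. I (t, u) \<partial>f) = (\<integral>\<^sup>+t. indicator {0..x} u * indicator {..ennreal u} t \<partial>f)"
      by (rule nn_integral_cong) (auto simp: I_def indicator_def)
    also have "\<dots> = indicator {0..x} u * emeasure f {..ennreal u}"
      by (subst nn_integral_cmult) auto
    also have "\<dots> = ennreal (F u) * indicator {0..x} u"
      using assms by (auto simp: indicator_def cdf_eq emeasure_eq_measure)
    finally show "ennreal (F u) * indicator {0..x} u = (\<integral>\<^sup>+t. I (t, u) \<partial>f)" ..
  qed
  also have "\<dots> = (\<integral>\<^sup>+t. \<integral>\<^sup>+u. I (t, u) \<partial>lborel \<partial>f)"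
    by (rule P.Fubini) measurable
  also have "\<dots> = (\<integral>\<^sup>+t. ennreal (if t \<le> ennreal x then x - enn2real t else 0) \<partial>f)"
  proof (rule nn_integral_cong)
    fix t :: ennreal
    have "(\<integral>\<^sup>+u. I (t, u) \<partial>lborel) =
        (\<integral>\<^sup>+u. indicator (if t \<le> ennreal x then {enn2real t..x} else {}) u \<partial>lborel)"
    proof (rule nn_integral_cong)
      fix u :: real
      \<comment> \<open>Since \<open>ennreal u\<close> is 0 for negative \<open>u\<close>, the left
        side has to ask for \<open>0 \<le> u\<close>; on the right this comes from
        \<open>enn2real t \<ge> 0\<close>.\<close>
      have "0 \<le> u \<and> u \<le> x \<and> t \<le> ennreal u \<longleftrightarrow>
          t \<le> ennreal x \<and> enn2real t \<le> u \<and> u \<le> x"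
      proof (cases "0 \<le> u")
        case True
        then show ?thesis
          using assms by (auto simp: le_ennreal_iff)
      next
        case False
        then show ?thesis
          using enn2real_nonneg[of t] by linarith
      qed
      then show "I (t, u) = indicator (if t \<le> ennreal x then {enn2real t..x} else {}) u"
        by (auto simp: I_def indicator_def)
    qed
    also have "\<dots> = ennreal (if t \<le> ennreal x then x - enn2real t else 0)"
      using assms by (auto dest: enn2real_le)
    finally show "(\<integral>\<^sup>+u. I (t, u) \<partial>lborel) = \<dots>" .
  qed
  also have "\<dots> = ennreal (\<integral>t. (if t \<le> ennreal x then x - enn2real t else 0) \<partial>f)"
    using assms by (intro nn_integral_eq_integral integrable_le_1) (auto dest: enn2real_le)
  finally show ?thesis
    using assms
    by (subst (asm) ennreal_inj)
       (auto intro!: integral_nonneg integrable_on_mono cdf_mono F_nonneg Bochner_Integration.integral_nonneg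
         dest: enn2real_le)
qed

lemma nn_integral_affine:
  assumes "integrable f g" "\<And>t. 0 \<le> g t" "0 \<le> k"
  shows "(\<integral>\<^sup>+t. ennreal (1 + k * g t) \<partial>f) = ennreal (1 + k * (\<integral>t. g t \<partial>f))"
  using assms by (subst nn_integral_eq_integral) (auto simp: prob_space)

text \<open>The excess \<open>t + 1 - r\<close> on \<open>t \<le> r\<close> is an indicator minus
  the positive part of \<open>r - t\<close>; their expectations are \<open>F r\<close> and, by
  \<open>integral_cdf\<close>, the integral of \<open>F\<close>.\<close>

lemma expected_ratio_le_1:
  assumes "0 \<le> a" "a < 1" "0 < r" "r \<le> 1"
  shows "expected_ratio a f (ennreal r) = ennreal (1 + (1 - a) / r * (F r - integral {0..r} F))"
proof -
  let ?h = "\<lambda>t. if t \<le> ennreal r then enn2real t + 1 - r else 0"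
  have int: "integrable f (\<lambda>t. indicator {..ennreal r} t :: real)"
    by (rule integrable_const_bound[of _ 1]) (auto simp: indicator_def)
  have eq: "?h = (\<lambda>t. indicator {..ennreal r} t - (if t \<le> ennreal r then r - enn2real t else 0))"
    by (auto simp: indicator_def)
  have "integrable f ?h"
    unfolding eq using assms by (intro Bochner_Integration.integrable_diff int integrable_le_1) auto
  then have "expected_ratio a f (ennreal r) = ennreal (1 + (1 - a) / r * (\<integral>t. ?h t \<partial>f))"
    using assms unfolding expected_ratio_def cost_ratio_le_1[OF assms(3,4)]
    by (intro nn_integral_affine) (auto intro!: add_increasing)
  also have "(\<integral>t. ?h t \<partial>f) = F r - integral {0..r} F"
    unfolding eq using assms
    by (subst Bochner_Integration.integral_diff)
       (auto intro!: int integrable_le_1 simp: integral_cdf cdf_eq)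
  finally show ?thesis .
qed

lemma integrable_gt_1:
  assumes "0 \<le> r" "0 \<le> b"
  shows "integrable f (\<lambda>t. if t \<le> ennreal r then enn2real t else b)"
  by (rule integrable_const_bound[of _ "max r b"])
     (use assms in \<open>auto intro!: AE_I2 max.coboundedI1 dest: enn2real_le\<close>)

lemma expected_ratio_gt_1:
  assumes "0 \<le> a" "a < 1" "1 < r"
  shows "expected_ratio a f (ennreal r) = ennreal (1 + (1 - a) / (1 - a + a * r) *
    (\<integral>t. (if t \<le> ennreal r then enn2real t else r - 1) \<partial>f))"
  using assms unfolding expected_ratio_def cost_ratio_gt_1[OF assms]
  by (intro nn_integral_affine integrable_gt_1) auto

text \<open>Kept in \<open>ennreal\<close> to cover \<open>a = 0\<close>, where the factor of the
  mass at \<open>\<infinity>\<close> is infinite.\<close>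

lemma expected_ratio_infinity:
  "expected_ratio a f \<infinity> = 1 / ennreal a * emeasure f {\<infinity>} + emeasure f (- {\<infinity>})"
proof -
  have "expected_ratio a f \<infinity> =
      (\<integral>\<^sup>+t. 1 / ennreal a * indicator {\<infinity>} t + indicator (- {\<infinity>}) t \<partial>f)"
    unfolding expected_ratio_def by (rule nn_integral_cong) (auto simp: cost_ratio_def)
  then show ?thesis
    by (simp add: nn_integral_add nn_integral_cmult)
qed

lemma expected_ratio_infinity_pos:
  assumes "0 < a" "a < 1"
  shows "expected_ratio a f \<infinity> = ennreal (1 + measure f {\<infinity>} * (1 / a - 1))"
proof -
  have "1 / ennreal a = ennreal (1 / a)"
    using assms by (metis divide_ennreal ennreal_1 zero_le_one)
  moreover have "measure f (- {\<infinity>}) = 1 - measure f {\<infinity>}"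
    using prob_compl[of "{\<infinity>}"] by (simp add: Compl_eq_Diff_UNIV)
  ultimately have "expected_ratio a f \<infinity> =
      ennreal (1 / a) * ennreal (measure f {\<infinity>}) + ennreal (1 - measure f {\<infinity>})"
    by (simp only: expected_ratio_infinity emeasure_eq_measure)
  also have "\<dots> = ennreal (1 / a * measure f {\<infinity>} + (1 - measure f {\<infinity>}))"
    using assms by (subst ennreal_plus) (auto simp: ennreal_mult[symmetric])
  finally show ?thesis
    by (simp add: algebra_simps)
qed

text \<open>Stopping at \<open>\<infinity>\<close> suffices: both ratios possible there,
  \<open>1 / a\<close> and 1, are at least 1.\<close>

lemma competitive_ratio_ge_1:
  assumes "0 \<le> a" "a < 1"
  shows "1 \<le> competitive_ratio a f"
proof -
  have "1 \<le> 1 / ennreal a"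
  proof (cases "a = 0")
    case False
    then have "1 / ennreal a = ennreal (1 / a)"
      using assms by (metis divide_ennreal ennreal_1 less_eq_real_def zero_le_one)
    then show ?thesis
      using assms False by simp
  qed (simp add: ennreal_divide_zero)
  then have "1 * emeasure f {\<infinity>} + emeasure f (- {\<infinity>}) \<le> expected_ratio a f \<infinity>"
    unfolding expected_ratio_infinity by (intro add_mono mult_right_mono) auto
  moreover have "emeasure f {\<infinity>} + emeasure f (- {\<infinity>}) = 1"
    using emeasure_space_1 by (subst plus_emeasure) auto
  moreover have "expected_ratio a f \<infinity> \<le> competitive_ratio a f"
    unfolding competitive_ratio_def by (rule SUP_upper) auto
  ultimately show ?thesis
    by (simp add: order_trans)
qed

lemma measure_infinity_eq:
  assumes "emeasure f {1<..<\<infinity>} = 0"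
  shows "measure f {\<infinity>} = 1 - F 1" "measure f {1<..} = 1 - F 1"
proof -
  have *: "measure f {1<..} = 1 - F 1"
    using prob_compl[of "{..1}"] by (simp add: cdf_eq Compl_eq_Diff_UNIV[symmetric])
  have "measure f ({\<infinity>} \<union> {1<..<\<infinity>}) = measure f {\<infinity>}"
    using assms by (intro measure_Un_null_set) (auto simp: null_sets_def)
  moreover have "{\<infinity>} \<union> {1<..<\<infinity>} = {(1::ennreal)<..}"
    by (auto simp: less_top[symmetric])
  ultimately show "measure f {\<infinity>} = 1 - F 1" "measure f {1<..} = 1 - F 1"
    using * by auto
qed

end

section \<open>Bad intervals and their mass\<close>

text \<open>\<open>c * r - 1\<close> solves for the buying time at which the ratio, affine in
  \<open>t\<close> for \<open>t \<le> r\<close>, equals \<open>\<gamma>\<close>. Buying times beyond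
  \<open>r\<close> have ratio 1 and are never bad.\<close>

lemma bad_interval_le_1:
  assumes "0 \<le> a" "a < 1" "1 \<le> \<gamma>" "0 < r" "r \<le> 1"
  defines "c \<equiv> (\<gamma> - a) / (1 - a)"
  shows "bad_interval a \<gamma> (ennreal r) = {t. t \<le> ennreal r \<and> c * r - 1 < enn2real t}"
proof -
  have "\<gamma> < 1 + (1 - a) / r * (s + 1 - r) \<longleftrightarrow> c * r - 1 < s" for s
  proof -
    have "\<gamma> < 1 + (1 - a) / r * (s + 1 - r) \<longleftrightarrow> (\<gamma> - 1) * r < (1 - a) * (s + 1 - r)"
      using assms by (simp add: field_simps)
    also have "\<dots> \<longleftrightarrow> (\<gamma> - a) * r < (1 - a) * (s + 1)"
      by (simp add: algebra_simps)
    also have "\<dots> \<longleftrightarrow> c * r - 1 < s"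
      using assms by (simp add: c_def field_simps)
    finally show ?thesis .
  qed
  then show ?thesis
    using assms by (auto simp: bad_interval_def cost_ratio_le_1 ennreal_less_iff)
qed

text \<open>A buying time up to 1 has ratio at most \<open>1 + (1 - a) = 2 - a\<close> at a finite
  stopping time beyond 1, and ratio 1 at \<open>\<infinity>\<close>.\<close>

lemma bad_interval_gt_1:
  assumes "0 \<le> a" "a < 1" "2 - a \<le> \<gamma>" "1 < x"
  shows "bad_interval a \<gamma> x \<subseteq> {1<..}"
proof (cases x rule: ennreal_top_or_real)
  case 1
  then show ?thesis
    using assms by (auto simp: bad_interval_def cost_ratio_def split: if_splits)
next
  case (2 r)
  then have r: "1 < r" using assms by simp
  have "cost_ratio a t x \<le> ennreal \<gamma>" if "t \<le> 1" for t
  proof -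
    have t: "t \<le> ennreal r" "enn2real t \<le> 1"
      using that r enn2real_le[of t 1] by (auto intro: order_trans[of t 1])
    have "1 \<le> 1 - a + a * r"
      using assms r by (simp add: mult_le_cancel_left1)
    then have "(1 - a) / (1 - a + a * r) \<le> 1 - a"
      using assms by (simp add: divide_le_eq mult_le_cancel_left1)
    then have "(1 - a) / (1 - a + a * r) * enn2real t \<le> (1 - a) * 1"
      using t assms by (intro mult_mono) auto
    then show ?thesis
      using assms r t unfolding 2 by (subst cost_ratio_gt_1) (auto intro!: ennreal_leI)
  qed
  then show ?thesis
    unfolding bad_interval_def by (metis (mono_tags) greaterThan_iff mem_Collect_eq not_le subsetI)
qed

lemma competitive_ratio_le_iff:
  "competitive_ratio a f \<le> R \<longleftrightarrow> (\<forall>x>0. expected_ratio a f x \<le> R)"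
  by (auto simp: competitive_ratio_def SUP_le_iff)

context purchase
begin

lemma measure_bad_interval:
  assumes "0 \<le> a" "a < 1" "1 \<le> \<gamma>" "0 < r" "r \<le> 1"
  defines "c \<equiv> (\<gamma> - a) / (1 - a)"
  shows "measure f (bad_interval a \<gamma> (ennreal r)) =
    (if (c - 1) * r < 1 then F r - F (c * r - 1) else 0)"
proof -
  note bad = bad_interval_le_1[OF assms(1-5), folded c_def]
  \<comment> \<open>Either the threshold is negative, where \<open>F\<close> vanishes and all of
    \<open>[0, r]\<close> is bad; or it lies in \<open>[0, r)\<close>; or it has reached
    \<open>r\<close> and nothing is bad.\<close>
  consider "c * r - 1 < 0" | "0 \<le> c * r - 1" "(c - 1) * r < 1" | "1 \<le> (c - 1) * r"
    by linarith
  then show ?thesis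
  proof cases
    case 1
    then have "c * r - 1 < enn2real t" for t
      using enn2real_nonneg[of t] by linarith
    then have "bad_interval a \<gamma> (ennreal r) = {..ennreal r}"
      unfolding bad by auto
    moreover have "(c - 1) * r < 1"
      using 1 assms(4) unfolding left_diff_distrib by linarith
    ultimately show ?thesis
      using 1 assms(4,5) by (simp add: cdf_upto_1_def)
  next
    case 2
    then have le: "c * r - 1 \<le> r"
      by (simp add: algebra_simps)
    have "bad_interval a \<gamma> (ennreal r) = {..ennreal r} - {..ennreal (c * r - 1)}"
      unfolding bad using 2 assms(4) by (auto simp: le_ennreal_iff not_le)
    then show ?thesis
      using 2 le assms(4,5)
      by (simp add: cdf_eq finite_measure_Diff ennreal_leI)
  next
    case 3
    then have "r \<le> c * r - 1"
      by (simp add: algebra_simps)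
    then have "bad_interval a \<gamma> (ennreal r) = {}"
      unfolding bad using assms(4) by (auto dest: enn2real_le)
    then show ?thesis
      using 3 by simp
  qed
qed

section \<open>Necessary conditions on a feasible distribution of given ratio\<close>

lemma expected_ratio_le_1_iff:
  assumes "0 \<le> a" "a < 1" "0 \<le> \<theta>" "0 < r" "r \<le> 1"
  shows "expected_ratio a f (ennreal r) \<le> ennreal (1 + (1 - a) * \<theta>) \<longleftrightarrow>
    F r \<le> \<theta> * r + integral {0..r} F"
proof -
  have "expected_ratio a f (ennreal r) \<le> ennreal (1 + (1 - a) * \<theta>) \<longleftrightarrow>
      (1 - a) / r * (F r - integral {0..r} F) \<le> (1 - a) * \<theta>"
    using assms by (simp add: expected_ratio_le_1 ennreal_le_iff)
  also have "\<dots> \<longleftrightarrow> (F r - integral {0..r} F) \<le> \<theta> * r"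
    using assms by (simp add: divide_le_eq mult.assoc)
  finally show ?thesis
    by (simp add: algebra_simps)
qed

lemma expected_ratio_gt_1_iff:
  assumes "0 \<le> a" "a < 1" "0 \<le> \<theta>" "1 < r"
  shows "expected_ratio a f (ennreal r) \<le> ennreal (1 + (1 - a) * \<theta>) \<longleftrightarrow>
    (\<integral>t. (if t \<le> ennreal r then enn2real t else r - 1) \<partial>f) \<le> \<theta> * (1 + a * (r - 1))"
    (is "_ \<longleftrightarrow> ?I \<le> _")
proof -
  have pos: "0 < 1 - a + a * r"
    using assms by (intro add_pos_nonneg) auto
  have "expected_ratio a f (ennreal r) \<le> ennreal (1 + (1 - a) * \<theta>) \<longleftrightarrow>
      (1 - a) / (1 - a + a * r) * ?I \<le> (1 - a) * \<theta>"
    using assms by (simp add: expected_ratio_gt_1 ennreal_le_iff)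
  also have "\<dots> \<longleftrightarrow> ?I \<le> \<theta> * (1 - a + a * r)"
    using assms pos by (simp add: divide_le_eq mult.assoc)
  finally show ?thesis
    by (simp add: algebra_simps)
qed

lemma subsolution_cdf:
  assumes a: "0 \<le> a" "a < 1" and \<gamma>: "2 - a \<le> \<gamma>" and \<theta>: "0 \<le> \<theta>"
    and feasible: "feasible a \<gamma> \<delta> f"
    and ratio: "competitive_ratio a f \<le> ennreal (1 + (1 - a) * \<theta>)"
  shows "subsolution ((\<gamma> - a) / (1 - a)) \<delta> \<theta> F"
proof -
  let ?c = "(\<gamma> - a) / (1 - a)"
  have CR: "F r \<le> \<theta> * r + integral {0..r} F" if "0 < r" "r \<le> 1" for r
    using ratio that a \<theta>
    by (subst expected_ratio_le_1_iff[symmetric]) (auto simp: competitive_ratio_le_iff)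
  \<comment> \<open>An atom at 0 would make the ratio unbounded near 0: for small \<open>r\<close>,
    \<open>F 0 \<le> F r \<le> r * (\<theta> + 1)\<close>.\<close>
  have F0: "F 0 = 0"
  proof (rule antisym)
    show "F 0 \<le> 0"
    proof (rule field_le_epsilon)
      fix e :: real assume "e > 0"
      define r where "r = min 1 (e / (\<theta> + 1))"
      have r: "0 < r" "r \<le> 1" "r \<le> e / (\<theta> + 1)"
        using \<open>e > 0\<close> \<theta> by (auto simp: r_def)
      have "F 0 \<le> F r"
        using r by (intro monoD[OF cdf_mono]) auto
      also have "\<dots> \<le> \<theta> * r + integral {0..r} F"
        using r by (intro CR)
      also have "integral {0..r} F \<le> (r - 0) * F r"
        using r by (intro integral_mono_le cdf_mono) auto
      also have "\<dots> \<le> r * 1"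
        using r by (intro mult_mono) (auto simp: cdf_upto_1_def)
      finally have "F 0 \<le> r * (\<theta> + 1)"
        by (simp add: algebra_simps)
      also have "\<dots> \<le> e"
        using r(3) \<theta> by (simp add: pos_le_divide_eq)
      finally show "F 0 \<le> 0 + e" by simp
    qed
  qed (simp add: cdf_upto_1_def)
  show ?thesis
    unfolding subsolution_def
  proof (intro conjI allI impI ballI cdf_mono)
    fix x :: real assume "x \<le> 0"
    then show "F x = 0"
      using F0 by (cases "x = 0") (auto simp: cdf_upto_1_def)
  next
    fix x :: real assume "1 < x"
    then show "F x = F 1"
      by (simp add: cdf_upto_1_def)
  next
    fix x :: real assume x: "x \<in> {0..1}"
    show "F x \<le> \<theta> * x + integral {0..x} F"
      using CR[of x] x F0 by (cases "x = 0") auto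
    assume cx: "(?c - 1) * x < 1"
    have bound: "measure f (bad_interval a \<gamma> y) \<le> \<delta>" if "y > 0" for y
      using feasible that by (simp add: feasible_def)
    show "F x \<le> \<delta> + F (?c * x - 1)"
    proof (cases "x = 0")
      case True
      \<comment> \<open>At 0 no tail constraint is available; the sign of \<open>\<delta>\<close> is
        read off the one at stopping time 1.\<close>
      have "0 \<le> \<delta>"
        using order_trans[OF measure_nonneg bound[of 1]] by simp
      with True F0 show ?thesis
        by (simp add: cdf_upto_1_def)
    next
      case False
      then have "F x - F (?c * x - 1) \<le> \<delta>"
        using bound[of "ennreal x"] measure_bad_interval[of a \<gamma> x] cx x a \<gamma> by simp
      then show ?thesis by simp
    qed
  qed
qed

text \<open>This is the ratio constraint at \<open>\<infinity>\<close>. For \<open>a = 0\<close>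
  never buying has infinite ratio there, so it carries no mass; otherwise its mass times
  \<open>1 / a - 1\<close> is at most \<open>(1 - a) * \<theta>\<close>.\<close>

lemma measure_infinity_le:
  assumes a: "0 \<le> a" "a < 1" and ratio: "competitive_ratio a f \<le> ennreal (1 + (1 - a) * \<theta>)"
    and \<theta>: "0 \<le> \<theta>"
  shows "measure f {\<infinity>} \<le> a * \<theta>"
proof (cases "a = 0")
  case True
  have "1 / ennreal a * emeasure f {\<infinity>} \<le> expected_ratio a f \<infinity>"
    unfolding expected_ratio_infinity by simp
  also have "\<dots> \<le> ennreal (1 + (1 - a) * \<theta>)"
    using ratio by (simp add: competitive_ratio_le_iff)
  also have "\<dots> < \<infinity>" by simp
  finally have "emeasure f {\<infinity>} = 0"
    using True by (auto simp: ennreal_top_mult split: if_splits)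
  then show ?thesis
    using True by (simp add: measure_def)
next
  case False
  have "expected_ratio a f \<infinity> \<le> ennreal (1 + (1 - a) * \<theta>)"
    using ratio by (auto simp: competitive_ratio_le_iff)
  then have "measure f {\<infinity>} * (1 / a - 1) \<le> (1 - a) * \<theta>"
    using a False \<theta> by (subst (asm) expected_ratio_infinity_pos) auto
  also have "measure f {\<infinity>} * (1 / a - 1) = (1 - a) * (measure f {\<infinity>} / a)"
    using False by (simp add: field_simps)
  finally show ?thesis
    using a False by (simp add: divide_le_eq mult.commute)
qed

text \<open>Stopping at \<open>k + 1\<close>, where \<open>(k, k + 1]\<close> is the first such interval that carries mass,
  and stopping at \<open>1\<close>: in the average of the two constraints with weights \<open>1 / k\<close> and
  \<open>1 - 1 / k\<close>, a buying time in \<open>(1, \<infinity>)\<close> weighs at least as much as not buying at all.\<close>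

lemma integral_cdf_ge:
  assumes a: "0 \<le> a" "a < 1" and \<theta>: "0 \<le> \<theta>"
    and ratio: "competitive_ratio a f \<le> ennreal (1 + (1 - a) * \<theta>)"
  shows "1 \<le> \<theta> * (1 + a) + integral {0..1} F"
    and "emeasure f {1<..<\<infinity>} \<noteq> 0 \<Longrightarrow> 1 < \<theta> * (1 + a) + integral {0..1} F"
proof -
  \<comment> \<open>\<open>e\<close> and \<open>h k\<close> are the excesses for stopping at 1 and
    at \<open>k + 1\<close>, and \<open>g\<close> has mean \<open>1 - integral {0..1} F\<close>.
    \<open>D k\<close> is the weighted average minus \<open>g\<close>, so the claims follow once its
    mean is nonnegative or positive.\<close>
  define e where "e = (\<lambda>t::ennreal. if t \<le> ennreal 1 then enn2real t else 0)"
  define g where "g = (\<lambda>t::ennreal. if t \<le> ennreal 1 then enn2real t else 1)"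
  define h where "h = (\<lambda>(k::real) t::ennreal. if t \<le> ennreal (k + 1) then enn2real t else k)"
  define D where "D = (\<lambda>k t. h k t / k + (1 - 1 / k) * e t - g t)"
  have int [simp]: "integrable f e" "integrable f g" "\<And>k. 0 \<le> k \<Longrightarrow> integrable f (h k)"
    unfolding e_def g_def h_def by (auto intro!: integrable_gt_1 simp del: ennreal_1)
  have g: "(\<integral>t. g t \<partial>f) = 1 - integral {0..1} F"
  proof -
    have "g = (\<lambda>t. 1 - (if t \<le> ennreal 1 then 1 - enn2real t else 0))"
      by (auto simp: g_def)
    then show ?thesis
      using integrable_le_1[of 1] integral_cdf[of 1] by simp
  qed
  have e: "(\<integral>t. e t \<partial>f) \<le> \<theta>"
  proof -
    have eq: "e = (\<lambda>t. indicator {..ennreal 1} t - (if t \<le> ennreal 1 then 1 - enn2real t else 0))"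
      by (auto simp: e_def indicator_def)
    have "integrable f (\<lambda>t. indicator {..ennreal 1} t :: real)"
      by (rule integrable_const_bound[of _ 1]) (auto simp: indicator_def)
    then have "(\<integral>t. e t \<partial>f) = F 1 - integral {0..1} F"
      unfolding eq using integrable_le_1[of 1]
      by (subst Bochner_Integration.integral_diff) (auto simp: integral_cdf cdf_eq)
    also have "\<dots> \<le> \<theta>"
      using expected_ratio_le_1_iff[OF a \<theta>, of 1] ratio by (simp add: competitive_ratio_le_iff)
    finally show ?thesis .
  qed
  have h: "(\<integral>t. h k t \<partial>f) \<le> \<theta> * (1 + a * k)" if "0 < k" for k
  proof -
    have "expected_ratio a f (ennreal (k + 1)) \<le> ennreal (1 + (1 - a) * \<theta>)"
      using ratio that unfolding competitive_ratio_le_iff by simp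
    then show ?thesis
      using a \<theta> that by (subst (asm) expected_ratio_gt_1_iff) (auto simp: h_def cong: if_cong)
  qed
  have D_le: "(\<integral>t. D k t \<partial>f) \<le> \<theta> * (1 + a) - (1 - integral {0..1} F)" if "1 \<le> k" for k
  proof -
    have "(\<integral>t. D k t \<partial>f) = (\<integral>t. h k t \<partial>f) / k + (1 - 1 / k) * (\<integral>t. e t \<partial>f) - (\<integral>t. g t \<partial>f)"
      unfolding D_def using that by simp
    also have "\<dots> \<le> \<theta> * (1 + a * k) / k + (1 - 1 / k) * \<theta> - (1 - integral {0..1} F)"
      unfolding g using that h[of k] e
      by (intro diff_right_mono add_mono divide_right_mono mult_left_mono) auto
    \<comment> \<open>The weights cancel the dependence on \<open>k\<close>.\<close>
    also have "\<theta> * (1 + a * k) / k + (1 - 1 / k) * \<theta> = \<theta> * (1 + a)"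
      using that by (simp add: field_simps)
    finally show ?thesis .
  qed
  have D_int: "integrable f (D k)" if "1 \<le> k" for k
    unfolding D_def using that by simp
  \<comment> \<open>\<open>D k\<close> vanishes up to 1 and beyond \<open>k + 1\<close>, and on
    \<open>(k, k + 1]\<close> it is \<open>t / k - 1 > 0\<close>. Only \<open>1 < t \<le> k\<close>
    can make it negative.\<close>
  have D_1: "D k t = 0" if "1 \<le> k" "t \<le> 1" for k t
  proof -
    have "t \<le> ennreal (k + 1)"
      using that(1) by (intro order_trans[OF that(2)]) simp
    then show ?thesis
      using that by (simp add: D_def e_def g_def h_def left_diff_distrib)
  qed
  have D_mid: "0 < D k t" if "1 \<le> k" "ennreal k < t" "t \<le> ennreal (k + 1)" for k t
  proof -
    have "1 < t"
      using that(1) by (intro le_less_trans[OF _ that(2)]) simp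
    moreover have "k < enn2real t"
      using that by (cases t) (auto simp: ennreal_less_iff top_unique)
    ultimately have "\<not> t \<le> 1" "1 < enn2real t / k"
      using that(1) by auto
    then show ?thesis
      using that(3) by (simp add: D_def e_def g_def h_def)
  qed
  have D_far: "D k t = 0" if "1 \<le> k" "ennreal (k + 1) < t" for k t
  proof -
    have "1 < t"
      using that(1) by (intro le_less_trans[OF _ that(2)]) simp
    then have "\<not> t \<le> 1" "\<not> t \<le> ennreal (k + 1)"
      using that(2) by auto
    then show ?thesis
      using that(1) by (simp add: D_def e_def g_def h_def)
  qed
  have D_nonneg: "0 \<le> D k t" if k: "1 \<le> k" "\<not> (1 < t \<and> t \<le> ennreal k)" for k t
  proof -
    consider "t \<le> 1" | "ennreal k < t" "t \<le> ennreal (k + 1)" | "ennreal (k + 1) < t"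
      using k(2) by (meson not_le)
    then show ?thesis
      using k(1) D_1[of k t] D_mid[of k t] D_far[of k t] by cases auto
  qed
  \<comment> \<open>For \<open>k = 1\<close> the exceptional interval \<open>(1, 1]\<close> is
    empty.\<close>
  have "0 \<le> (\<integral>t. D 1 t \<partial>f)"
    by (intro Bochner_Integration.integral_nonneg D_nonneg) auto
  then show "1 \<le> \<theta> * (1 + a) + integral {0..1} F"
    using D_le[of 1] by simp
  assume pos: "emeasure f {1<..<\<infinity>} \<noteq> 0"
  have "\<exists>n. emeasure f {1<..ennreal (real n + 1)} \<noteq> 0"
  proof (rule ccontr)
    assume "\<not> ?thesis"
    then have "emeasure f (\<Union>n. {1<..ennreal (real n + 1)}) = 0"
      by (intro emeasure_UN_eq_0) auto
    moreover have "{1<..<\<infinity>} \<subseteq> (\<Union>n. {1<..ennreal (real n + 1)})"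
    proof
      fix t :: ennreal assume t: "t \<in> {1<..<\<infinity>}"
      obtain n where "enn2real t \<le> real n"
        using real_arch_simple by blast
      then have "t \<le> ennreal (real n + 1)"
        using t by (cases t) (auto intro!: ennreal_leI)
      then show "t \<in> (\<Union>n. {1<..ennreal (real n + 1)})"
        using t by auto
    qed
    ultimately show False
      using pos emeasure_mono[of "{1<..<\<infinity>}" "\<Union>n. {1<..ennreal (real n + 1)}" f] by auto
  qed
  \<comment> \<open>By minimality, for \<open>k = n\<close> the interval \<open>(1, k]\<close> is
    null while \<open>(1, k + 1]\<close> is not, so \<open>D k\<close> is nonnegative almost
    everywhere and positive on a set of positive mass.\<close>
  then obtain n where n: "emeasure f {1<..ennreal (real n + 1)} \<noteq> 0"
      "\<And>m. m < n \<Longrightarrow> emeasure f {1<..ennreal (real m + 1)} = 0"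
    using exists_least_iff[of "\<lambda>n. emeasure f {1<..ennreal (real n + 1)} \<noteq> 0"] by blast
  have "n \<noteq> 0"
  proof
    assume "n = 0"
    with n(1) show False by simp
  qed
  define k where "k = real n"
  have k: "1 \<le> k" "emeasure f {1<..ennreal k} = 0" "emeasure f {1<..ennreal (k + 1)} \<noteq> 0"
    using n(1) n(2)[of "n - 1"] \<open>n \<noteq> 0\<close> by (auto simp: k_def)
  have AE_k: "AE t in f. \<not> (1 < t \<and> t \<le> ennreal k)"
    using k(2) by (intro AE_I[of _ _ "{1<..ennreal k}"]) auto
  then have AE_D: "AE t in f. 0 \<le> D k t"
    by eventually_elim (intro D_nonneg k)
  have "(\<integral>t. D k t \<partial>f) \<noteq> 0"
  proof
    assume "(\<integral>t. D k t \<partial>f) = 0"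
    then have "AE t in f. D k t = 0"
      using integral_nonneg_eq_0_iff_AE[OF D_int[OF k(1)] AE_D] by simp
    with AE_k have "AE t in f. \<not> (1 < t \<and> t \<le> ennreal (k + 1))"
    proof eventually_elim
      case (elim t)
      then show ?case
        using D_mid[OF k(1), of t] by (metis less_irrefl not_le)
    qed
    then have "emeasure f {1<..ennreal (k + 1)} = 0"
      by (subst (asm) AE_iff_measurable[of "{1<..ennreal (k + 1)}"]) auto
    with k(3) show False ..
  qed
  moreover have "0 \<le> (\<integral>t. D k t \<partial>f)"
    using AE_D by (rule Bochner_Integration.integral_nonneg_AE)
  ultimately show "1 < \<theta> * (1 + a) + integral {0..1} F"
    using D_le[OF k(1)] by simp
qed

end

section \<open>Distributions from distribution functions: uniqueness and existence\<close>

text \<open>The rays \<open>{x<..}\<close> form a generator closed under intersection. Without mass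
  in \<open>(1, \<infinity>)\<close>, the mass of a ray is determined by the distribution function
  on [0,1].\<close>

lemma purchase_eqI:
  assumes f: "purchase f" "emeasure f {1<..<\<infinity>} = 0"
    and g: "purchase g" "emeasure g {1<..<\<infinity>} = 0"
    and eq: "cdf_upto_1 f = cdf_upto_1 g"
  shows "f = g"
proof -
  interpret f: purchase f by fact
  interpret g: purchase g by fact
  \<comment> \<open>No ray contains 0, so \<open>UNIV\<close> is adjoined to have a cover of the
    space among the generators.\<close>
  have gen: "sets borel = sigma_sets UNIV (insert UNIV (range greaterThan :: ennreal set set))"
  proof -
    have "sets borel = sigma_sets UNIV (range greaterThan :: ennreal set set)"
      by (simp add: borel_Ioi)
    also have "\<dots> = sigma_sets UNIV (insert UNIV (range greaterThan))"
      by (intro sigma_sets_eqI) (auto intro: sigma_sets_top)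
    finally show ?thesis .
  qed
  have le: "measure h {..ennreal r} = cdf_upto_1 h (min r 1)"
    if h: "purchase h" "emeasure h {1<..<\<infinity>} = 0" and r: "0 \<le> r" for h r
  proof -
    interpret h: purchase h by fact
    show ?thesis
    proof (cases "r \<le> 1")
      case True
      with r show ?thesis by (simp add: h.cdf_eq)
    next
      case False
      then have "1 \<le> ennreal r" by simp
      then have split: "{..ennreal r} = {..1} \<union> {1<..ennreal r}"
        by (auto intro: order_trans[OF _ \<open>1 \<le> ennreal r\<close>])
      have "emeasure h {1<..ennreal r} \<le> emeasure h {1<..<\<infinity>}"
        by (intro emeasure_mono) (auto simp: less_top[symmetric] top_unique)
      then have "measure h {..ennreal r} = measure h {..1}"
        unfolding split using h(2) by (intro measure_Un_null_set) (auto simp: null_sets_def)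
      with False show ?thesis by (simp add: h.cdf_eq)
    qed
  qed
  have greaterThan: "emeasure f {x<..} = emeasure g {x<..}" for x
  proof (cases x rule: ennreal_top_or_real)
    case (2 r)
    then have "measure f {..x} = measure g {..x}"
      using le[OF f] le[OF g] eq by simp
    moreover have "{x<..} = UNIV - {..x}"
      by auto
    ultimately show ?thesis
      using f.prob_compl[of "{..x}"] g.prob_compl[of "{..x}"]
      by (simp add: f.emeasure_eq_measure g.emeasure_eq_measure)
  next
    case 1
    then have "{x<..} = {}"
      by (auto simp: set_eq_iff not_less)
    then show ?thesis by simp
  qed
  show ?thesis
  proof (rule measure_eqI_generator_eq[where E = "insert UNIV (range greaterThan)" and \<Omega> = UNIV
        and A = "\<lambda>_. UNIV"])
    show "Int_stable (insert UNIV (range (greaterThan :: ennreal \<Rightarrow> _)))"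
    proof -
      have "{x<..} \<inter> {y<..} = {max x y<..}" for x y :: ennreal
        by auto
      then show ?thesis
        by (auto simp: Int_stable_def)
    qed
    show "emeasure f X = emeasure g X" if "X \<in> insert UNIV (range greaterThan)" for X
      using that greaterThan by (elim insertE imageE) (simp_all add: f.emeasure_eq_measure g.emeasure_eq_measure)
    show "sets f = sigma_sets UNIV (insert UNIV (range greaterThan))"
      "sets g = sigma_sets UNIV (insert UNIV (range greaterThan))"
      using gen f.sets_f g.sets_f by simp_all
    show "emeasure f UNIV \<noteq> \<infinity>"
      by (simp add: f.emeasure_eq_measure)
  qed auto
qed

text \<open>The missing mass \<open>1 - F 1\<close> is parked at the real point 2, which gives a
  real distribution, and \<open>T\<close> then moves it to \<open>\<infinity>\<close>.\<close>

lemma ex_purchase_cdf: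
  fixes F :: "real \<Rightarrow> real"
  assumes "mono F" and cont: "\<And>x. continuous (at_right x) F"
    and F_neg: "\<And>x. x < 0 \<Longrightarrow> F x = 0" and F_1: "F 1 \<le> 1" and F_gt: "\<And>x. 1 < x \<Longrightarrow> F x = F 1"
  obtains f where "purchase f" "cdf_upto_1 f = F" "emeasure f {1<..<\<infinity>} = 0"
proof -
  define H where "H = (\<lambda>x. if x < 2 then F x else 1)"
  have F_le: "F x \<le> 1" for x
    using monoD[OF \<open>mono F\<close>, of x 1] F_1 F_gt[of x] by (cases "x \<le> 1") auto
  have H_mono: "H x \<le> H y" if "x \<le> y" for x y
    using that F_le monoD[OF \<open>mono F\<close> that] by (auto simp: H_def)
  have H_cont: "continuous (at_right x) H" for x
  proof (subst continuous_at_right_real_increasing)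
    show "\<forall>e>0. \<exists>d>0. H (x + d) - H x < e"
    proof (intro allI impI)
      fix e :: real assume "e > 0"
      show "\<exists>d>0. H (x + d) - H x < e"
      proof (cases "x < 2")
        case True
        have "\<forall>e>0. \<exists>d>0. F (x + d) - F x < e"
          using cont[of x] monoD[OF \<open>mono F\<close>]
          by (subst (asm) continuous_at_right_real_increasing)
        then obtain d where d: "d > 0" "F (x + d) - F x < e"
          using \<open>e > 0\<close> by blast
        have "F (x + min d ((2 - x) / 2)) \<le> F (x + d)"
          by (intro monoD[OF \<open>mono F\<close>]) simp
        then show ?thesis
          using d True by (intro exI[of _ "min d ((2 - x) / 2)"]) (auto simp: H_def min_def field_simps)
      next
        case False
        then show ?thesis
          using \<open>e > 0\<close> by (intro exI[of _ 1]) (auto simp: H_def)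
      qed
    qed
  qed (rule H_mono)
  have H_bot: "(H \<longlongrightarrow> 0) at_bot"
    by (rule tendsto_eventually) (auto simp: H_def F_neg eventually_at_bot_dense intro!: exI[of _ 0])
  have H_top: "(H \<longlongrightarrow> 1) at_top"
    by (rule tendsto_eventually) (auto simp: H_def eventually_at_top_linorder intro!: exI[of _ 2])
  define \<mu> where "\<mu> = interval_measure H"
  interpret \<mu>: real_distribution \<mu>
    unfolding \<mu>_def by (rule real_distribution_interval_measure) (fact H_mono H_cont H_bot H_top)+
  define T where "T = (\<lambda>t::real. if t \<le> 1 then ennreal t else \<infinity>)"
  have T [measurable]: "T \<in> borel_measurable borel"
    unfolding T_def by measurable
  define f where "f = distr \<mu> borel T"
  have f: "purchase f"
    unfolding purchase_iff purchase_distribution_def f_def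
    by (auto intro!: \<mu>.prob_space_distr)
  have "cdf_upto_1 f x = F x" for x
  proof (cases "x < 0")
    case True
    then show ?thesis by (simp add: cdf_upto_1_def F_neg)
  next
    case False
    define y where "y = min x 1"
    have y: "0 \<le> y" "y \<le> 1"
      using False by (auto simp: y_def)
    have "measure f {..ennreal y} = measure \<mu> (T -` {..ennreal y} \<inter> space \<mu>)"
      unfolding f_def by (rule measure_distr) auto
    also have "T -` {..ennreal y} \<inter> space \<mu> = {..y}"
      using y by (auto simp: T_def top_unique split: if_splits)
    also have "measure \<mu> {..y} = H y"
      unfolding \<mu>_def by (rule measure_interval_measure_Iic) (fact H_mono H_cont H_bot)+
    also have "\<dots> = F y"
      using y by (simp add: H_def)
    also have "\<dots> = F x"
      using F_gt[of x] by (simp add: y_def min_def)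
    finally show ?thesis
      using False by (simp add: cdf_upto_1_def y_def)
  qed
  moreover have "emeasure f {1<..<\<infinity>} = 0"
  proof -
    have "T -` {1<..<\<infinity>} \<inter> space \<mu> = {}"
      by (auto simp: T_def split: if_splits)
    then show ?thesis
      unfolding f_def by (subst emeasure_distr) auto
  qed
  ultimately show ?thesis
    using f that[of f] by blast
qed

section \<open>Sufficient conditions for ratio and feasibility\<close>

context purchase
begin

text \<open>All mass beyond 1 sits at \<open>\<infinity>\<close> and equals
  \<open>a * \<theta>\<close>. Stopping at \<open>r > 1\<close> thus has expected excess at most
  \<open>\<theta> + (r - 1) * (a * \<theta>)\<close>, exactly the allowed
  \<open>\<theta> * (1 + a * (r - 1))\<close>.\<close>

lemma competitive_ratio_le:
  assumes a: "0 \<le> a" "a < 1" and \<theta>: "0 \<le> \<theta>"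
    and F: "\<And>r. 0 < r \<Longrightarrow> r \<le> 1 \<Longrightarrow> F r \<le> \<theta> * r + integral {0..r} F"
    and F_1: "F 1 = 1 - a * \<theta>" and null: "emeasure f {1<..<\<infinity>} = 0"
  shows "competitive_ratio a f \<le> ennreal (1 + (1 - a) * \<theta>)"
  unfolding competitive_ratio_le_iff
proof (intro allI impI)
  have q: "measure f {\<infinity>} = a * \<theta>"
    using measure_infinity_eq[OF null] F_1 by simp
  fix x :: ennreal assume "0 < x"
  show "expected_ratio a f x \<le> ennreal (1 + (1 - a) * \<theta>)"
  proof (cases x rule: ennreal_top_or_real)
    case 1
    show ?thesis
    proof (cases "a = 0")
      case True
      then have "emeasure f {\<infinity>} = 0"
        using q by (simp add: emeasure_eq_measure)
      moreover have "emeasure f (- {\<infinity>}) \<le> 1"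
        by (rule emeasure_le_1)
      ultimately show ?thesis
        unfolding 1 expected_ratio_infinity using a \<theta> by (simp add: order_trans[OF _ ennreal_leI[of 1]])
    next
      case False
      have "a * \<theta> * (1 / a - 1) = (1 - a) * \<theta>"
        using False by (simp add: field_simps)
      moreover have "0 < a"
        using False a by simp
      ultimately show ?thesis
        unfolding 1 expected_ratio_infinity_pos[OF \<open>0 < a\<close> a(2)] q by (simp only: order_refl)
    qed
  next
    case (2 r)
    show ?thesis
    proof (cases "r \<le> 1")
      case True
      then show ?thesis
        unfolding 2 using a \<theta> F[of r] \<open>0 < x\<close> 2 by (subst expected_ratio_le_1_iff) auto
    next
      case False
      let ?e = "\<lambda>t. if t \<le> ennreal 1 then enn2real t else 0"
      have eq: "?e = (\<lambda>t. indicator {..ennreal 1} t - (if t \<le> ennreal 1 then 1 - enn2real t else 0))"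
        by (auto simp: indicator_def)
      have int_ind: "integrable f (\<lambda>t. indicator {..ennreal 1} t :: real)"
        "integrable f (\<lambda>t. indicator {\<infinity>} t :: real)"
        by (rule integrable_const_bound[of _ 1]; auto simp: indicator_def)+
      have "(\<integral>t. ?e t \<partial>f) = F 1 - integral {0..1} F"
        unfolding eq using integrable_le_1[of 1] int_ind
        by (subst Bochner_Integration.integral_diff) (auto simp: integral_cdf cdf_eq)
      also have "\<dots> \<le> \<theta>"
        using F[of 1] by simp
      finally have e: "(\<integral>t. ?e t \<partial>f) \<le> \<theta>" .
      have AE: "AE t in f. (if t \<le> ennreal r then enn2real t else r - 1) =
          ?e t + (r - 1) * indicator {\<infinity>} t"
      proof -
        have "AE t in f. t \<notin> {1<..<\<infinity>}"
          using null by (intro AE_not_in) (auto simp: null_sets_def)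
        then show ?thesis
        proof eventually_elim
          case (elim t)
          then consider "t \<le> 1" | "t = \<infinity>"
            by (auto simp: less_top[symmetric])
          then show ?case
          proof cases
            case 1
            then have "t \<le> ennreal r"
              using False by (intro order_trans[OF 1]) simp
            then show ?thesis
              using 1 by (auto simp: indicator_def top_unique)
          qed (auto simp: top_unique)
        qed
      qed
      have int_e: "integrable f ?e"
        by (rule integrable_gt_1) auto
      have "(\<integral>t. (if t \<le> ennreal r then enn2real t else r - 1) \<partial>f) =
          (\<integral>t. ?e t + (r - 1) * indicator {\<infinity>} t \<partial>f)"
        using AE by (intro integral_cong_AE) auto
      also have "\<dots> = (\<integral>t. ?e t \<partial>f) + (r - 1) * measure f {\<infinity>}"
        using int_e int_ind by simp
      also have "\<dots> \<le> \<theta> + (r - 1) * (a * \<theta>)"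
        using e q by simp
      also have "\<dots> = \<theta> * (1 + a * (r - 1))"
        by (simp add: algebra_simps)
      finally show ?thesis
        unfolding 2 using a \<theta> False by (subst expected_ratio_gt_1_iff) auto
    qed
  qed
qed

text \<open>For stopping times beyond 1 the bad interval lies in \<open>{1<..}\<close>, whose mass
  is \<open>1 - F 1\<close>.\<close>

lemma feasibleI:
  assumes a: "0 \<le> a" "a < 1" and \<gamma>: "2 - a \<le> \<gamma>" and F_1: "1 - F 1 \<le> \<delta>" "0 \<le> \<delta>"
    and null: "emeasure f {1<..<\<infinity>} = 0"
    and F: "\<And>r. 0 < r \<Longrightarrow> r \<le> 1 \<Longrightarrow> ((\<gamma> - a) / (1 - a) - 1) * r < 1 \<Longrightarrow>
      F r \<le> \<delta> + F ((\<gamma> - a) / (1 - a) * r - 1)"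
  shows "feasible a \<gamma> \<delta> f"
  unfolding feasible_def
proof (intro conjI allI impI)
  show "purchase_distribution f"
    using purchase_iff purchase_axioms by blast
  fix x :: ennreal assume "0 < x"
  show "measure f (bad_interval a \<gamma> x) \<le> \<delta>"
  proof (cases "x \<le> 1")
    case True
    then obtain r where r: "x = ennreal r" "0 < r" "r \<le> 1"
      using \<open>0 < x\<close> by (cases x) (auto simp: top_unique)
    show ?thesis
      unfolding r(1) using measure_bad_interval[of a \<gamma> r] F[of r] r a \<gamma> F_1
      by (cases "((\<gamma> - a) / (1 - a) - 1) * r < 1") simp_all
  next
    case False
    then have "measure f (bad_interval a \<gamma> x) \<le> measure f {1<..}"
      using bad_interval_gt_1[OF a \<gamma>, of x] by (intro finite_measure_mono) auto
    then show ?thesis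
      using measure_infinity_eq(2)[OF null] F_1 by simp
  qed
qed

end

section \<open>Optimality, uniqueness and tightness\<close>

theorem theorem2:
  fixes a \<gamma> \<delta> :: real
  assumes "0 \<le> a" and "a < 1"
    and "2 - a \<le> \<gamma>" and "ennreal \<gamma> < 1 / ennreal a"
    and "0 \<le> \<delta>" and "\<delta> \<le> 1"
    and "(OPT a \<gamma> \<delta> - 1) / (1 / ennreal a - 1) \<le> ennreal \<delta>"
  shows "(\<exists>!f. optimal a \<gamma> \<delta> f) \<and>
    (\<forall>f. optimal a \<gamma> \<delta> f \<longrightarrow>
       (\<forall>x\<in>{0..1}. CR_tight a \<gamma> \<delta> f x \<or> mass_tight a \<gamma> \<delta> f x) \<and>
       emeasure f {1<..<\<infinity>} = 0 \<and>
       (0 < a \<longrightarrow> emeasure f {\<infinity>} > 0))"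
proof -
  note a = assms(1,2) and \<gamma> = assms(3)
  define c where "c = (\<gamma> - a) / (1 - a)"
  interpret maximal_subsolution c \<delta>
    using a \<gamma> \<open>0 \<le> \<delta>\<close> by unfold_locales (auto simp: c_def le_divide_eq)
  obtain \<theta> where \<theta>: "0 < \<theta>" "\<phi> a \<theta> = 1"
    using ex_\<phi>_eq_1[OF a(1)] .
  then have "0 \<le> \<theta>" by simp
  define R where "R = 1 + (1 - a) * \<theta>"
  \<comment> \<open>This leaves mass \<open>a * \<theta>\<close> for \<open>\<infinity>\<close>, the
    most that \<open>measure_infinity_le\<close> permits.\<close>
  have M_at_1: "M \<theta> 1 = 1 - a * \<theta>"
    using M_1[OF \<open>0 \<le> \<theta>\<close>] \<theta>(2) by (simp add: \<phi>_def algebra_simps)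

  have subsol: "subsolution c \<delta> \<theta>' (cdf_upto_1 f)" "purchase f"
    if "feasible a \<gamma> \<delta> f" "competitive_ratio a f \<le> ennreal (1 + (1 - a) * \<theta>')" "0 \<le> \<theta>'" for f \<theta>'
  proof -
    show "purchase f"
      using that by (simp add: feasible_def purchase_iff)
    then show "subsolution c \<delta> \<theta>' (cdf_upto_1 f)"
      unfolding c_def using that a \<gamma> by (intro purchase.subsolution_cdf)
  qed

  \<comment> \<open>A ratio below \<open>R\<close> would have a parameter
    \<open>\<theta>' < \<theta>\<close> with \<open>\<phi> a \<theta>' \<ge> 1\<close>, against
    strict monotonicity.\<close>
  have lower: "ennreal R \<le> competitive_ratio a f" if f: "feasible a \<gamma> \<delta> f" for f
  proof (rule ccontr)
    assume "\<not> ?thesis"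
    then have less: "competitive_ratio a f < ennreal R" by simp
    interpret purchase f
      using f by (simp add: feasible_def purchase_iff)
    obtain R' where R': "0 \<le> R'" "competitive_ratio a f = ennreal R'"
      using less by (cases "competitive_ratio a f") auto
    have "1 \<le> R'"
      using competitive_ratio_ge_1[OF a] R' by simp
    define \<theta>' where "\<theta>' = (R' - 1) / (1 - a)"
    have \<theta>': "0 \<le> \<theta>'" "R' = 1 + (1 - a) * \<theta>'"
      using a \<open>1 \<le> R'\<close> by (auto simp: \<theta>'_def)
    have "R' < R"
      using less R' by (simp add: ennreal_less_iff)
    then have "\<theta>' < \<theta>"
      using a \<theta>'(2) by (simp add: R_def)
    have ratio: "competitive_ratio a f \<le> ennreal (1 + (1 - a) * \<theta>')"
      using R' \<theta>' by simp
    have "1 \<le> \<theta>' * (1 + a) + integral {0..1} (cdf_upto_1 f)"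
      using integral_cdf_ge(1)[OF a \<theta>'(1) ratio] .
    also have "integral {0..1} (cdf_upto_1 f) \<le> integral {0..1} (M \<theta>')"
      by (intro integral_le integrable_on_mono cdf_mono M_mono \<theta>' subsolution_le_M subsol f ratio)
    finally have "1 \<le> \<phi> a \<theta>'"
      by (simp add: \<phi>_def)
    with \<phi>_strict_mono[OF a(1) \<theta>'(1) \<open>\<theta>' < \<theta>\<close>] \<theta>(2) show False by simp
  qed
  then have R_le_OPT: "ennreal R \<le> OPT a \<gamma> \<delta>"
    unfolding OPT_def by (intro INF_greatest) auto

  \<comment> \<open>The hypothesis speaks of \<open>OPT\<close>, of which only the lower bound
    \<open>R\<close> is known so far. That direction suffices, since
    \<open>(R - 1) / (1 / a - 1) = a * \<theta>\<close>.\<close>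
  have q_le: "a * \<theta> \<le> \<delta>"
  proof (cases "a = 0")
    case False
    then have "0 < a" using a by simp
    have "1 / a - 1 = (1 - a) / a"
      using \<open>0 < a\<close> by (simp add: diff_divide_distrib)
    then have "ennreal (a * \<theta>) = ennreal ((R - 1) / (1 / a - 1))"
      using a by (simp add: R_def mult.commute)
    also have "\<dots> = (ennreal R - 1) / (ennreal (1 / a) - 1)"
    proof -
      have "0 \<le> R - 1" "0 < 1 / a - 1"
        using a \<open>0 < a\<close> \<theta> by (auto simp: R_def)
      then show ?thesis
        using ennreal_minus[of 1 R] ennreal_minus[of 1 "1 / a"] by (simp add: divide_ennreal[symmetric])
    qed
    also have "ennreal (1 / a) = 1 / ennreal a"
      using \<open>0 < a\<close> divide_ennreal[of 1 a] by simp
    also have "(ennreal R - 1) / (1 / ennreal a - 1) \<le> (OPT a \<gamma> \<delta> - 1) / (1 / ennreal a - 1)"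
      using R_le_OPT by (intro divide_right_mono_ennreal ennreal_minus_mono) auto
    also note assms(7)
    finally show ?thesis
      using \<open>0 \<le> \<delta>\<close> by simp
  qed (use \<open>0 \<le> \<delta>\<close> in simp)

  obtain f0 where f0: "purchase f0" "cdf_upto_1 f0 = M \<theta>" "emeasure f0 {1<..<\<infinity>} = 0"
  proof (rule ex_purchase_cdf[of "M \<theta>"])
    show "mono (M \<theta>)" "continuous (at_right x) (M \<theta>)" for x
      by (intro M_mono M_right_continuous \<open>0 \<le> \<theta>\<close>)+
    show "M \<theta> x = 0" if "x < 0" for x
      using that by (intro M_zero \<open>0 \<le> \<theta>\<close>) simp
    show "M \<theta> x = M \<theta> 1" if "1 < x" for x
      using that by (intro M_const \<open>0 \<le> \<theta>\<close>) simp
    show "M \<theta> 1 \<le> 1"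
      using M_at_1 a \<open>0 \<le> \<theta>\<close> by simp
  qed
  interpret f0: purchase f0 by (fact f0)
  have f0_feasible: "feasible a \<gamma> \<delta> f0"
    using a \<gamma> q_le M_at_1 f0(3) \<open>0 \<le> \<delta>\<close> M_mass[OF \<open>0 \<le> \<theta>\<close>, unfolded c_def]
    by (intro f0.feasibleI) (auto simp: f0(2) c_def)
  have f0_ratio: "competitive_ratio a f0 \<le> ennreal R"
    unfolding R_def using a \<open>0 \<le> \<theta>\<close> M_at_1 f0(3) M_integral[OF \<open>0 \<le> \<theta>\<close>]
    by (intro f0.competitive_ratio_le) (auto simp: f0(2))
  have OPT: "OPT a \<gamma> \<delta> = ennreal R"
  proof (rule antisym)
    show "OPT a \<gamma> \<delta> \<le> ennreal R"
      unfolding OPT_def using f0_feasible f0_ratio by (intro INF_lower2[of f0]) auto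
  qed fact
  have f0_optimal: "optimal a \<gamma> \<delta> f0"
    using f0_feasible f0_ratio lower[OF f0_feasible] OPT by (simp add: optimal_def)

  have optimal_eq: "f = f0" if "optimal a \<gamma> \<delta> f" for f
  proof -
    have f: "feasible a \<gamma> \<delta> f" and ratio: "competitive_ratio a f \<le> ennreal (1 + (1 - a) * \<theta>)"
      using that OPT by (auto simp: optimal_def R_def)
    interpret purchase f
      using f by (simp add: feasible_def purchase_iff)
    note F = subsol(1)[OF f ratio \<open>0 \<le> \<theta>\<close>]
    have le: "cdf_upto_1 f x \<le> M \<theta> x" for x
      using F by (rule subsolution_le_M)
    have int_le: "integral {0..1} (cdf_upto_1 f) \<le> integral {0..1} (M \<theta>)"
      by (intro integral_le integrable_on_mono cdf_mono M_mono le \<open>0 \<le> \<theta>\<close>)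
    \<comment> \<open>Mass in \<open>(1, \<infinity>)\<close> would make the estimate strict and
      give \<open>\<phi> a \<theta> > 1\<close>.\<close>
    have null: "emeasure f {1<..<\<infinity>} = 0"
      using integral_cdf_ge(2)[OF a \<open>0 \<le> \<theta>\<close> ratio] int_le \<theta>(2) unfolding \<phi>_def by linarith
    have "integral {0..1} (M \<theta>) \<le> integral {0..1} (cdf_upto_1 f)"
      using integral_cdf_ge(1)[OF a \<open>0 \<le> \<theta>\<close> ratio] \<theta>(2) unfolding \<phi>_def by linarith
    then have eq: "cdf_upto_1 f x = M \<theta> x" if "0 \<le> x" "x < 1" for x
      using that le cdf_mono cdf_right_continuous \<open>0 \<le> \<theta>\<close> by (intro eq_M_if_integral_eq)
    \<comment> \<open>Comparing integrals does not determine the value at 1. There the bound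
      \<open>a * \<theta>\<close> on the mass at \<open>\<infinity>\<close> forces at least
      \<open>1 - a * \<theta> = M \<theta> 1\<close>.\<close>
    have eq_1: "cdf_upto_1 f 1 = M \<theta> 1"
      using measure_infinity_eq(1)[OF null] measure_infinity_le[OF a ratio \<open>0 \<le> \<theta>\<close>] le[of 1] M_at_1
      by simp
    have "cdf_upto_1 f x = M \<theta> x" for x
    proof -
      consider "x < 0" | "0 \<le> x" "x < 1" | "1 \<le> x" by linarith
      then show ?thesis
        using eq[of x] eq_1 subsolutionD(2,3)[OF F, of x] M_zero[OF \<open>0 \<le> \<theta>\<close>, of x]
          M_const[OF \<open>0 \<le> \<theta>\<close>, of x] by cases auto
    qed
    then show ?thesis
      using purchase_axioms null f0 by (intro purchase_eqI) auto
  qed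

  \<comment> \<open>The second claim prepares the right limit at 0: where
    \<open>M \<theta> r < \<delta>\<close>, nonnegativity of \<open>M \<theta>\<close> excludes the
    mass alternative of \<open>M_tight\<close>.\<close>
  have tight: "CR_tight a \<gamma> \<delta> f0 (ennreal r) \<or> mass_tight a \<gamma> \<delta> f0 (ennreal r)"
    and CR_tight_if: "M \<theta> r < \<delta> \<Longrightarrow> expected_ratio a f0 (ennreal r) = OPT a \<gamma> \<delta>"
    if r: "0 < r" "r \<le> 1" for r
  proof -
    have ratio: "expected_ratio a f0 (ennreal r) = OPT a \<gamma> \<delta>"
      if "M \<theta> r = \<theta> * r + integral {0..r} (M \<theta>)"
      using f0.expected_ratio_le_1[OF a r] that r by (simp add: f0(2) OPT R_def)
    have mass: "measure f0 (bad_interval a \<gamma> (ennreal r)) = \<delta>"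
      if "(c - 1) * r < 1" "M \<theta> r = \<delta> + M \<theta> (c * r - 1)"
      using f0.measure_bad_interval[of a \<gamma> r] that r a \<gamma> by (simp add: f0(2) c_def)
    show "CR_tight a \<gamma> \<delta> f0 (ennreal r) \<or> mass_tight a \<gamma> \<delta> f0 (ennreal r)"
      using M_tight[OF \<open>0 \<le> \<theta>\<close>, of r] r ratio mass by (auto simp: CR_tight_def mass_tight_def)
    show "expected_ratio a f0 (ennreal r) = OPT a \<gamma> \<delta>" if "M \<theta> r < \<delta>"
      using M_tight[OF \<open>0 \<le> \<theta>\<close>, of r] M_nonneg[OF \<open>0 \<le> \<theta>\<close>, of "c * r - 1"] that r ratio by auto
  qed
  have tight_0: "CR_tight a \<gamma> \<delta> f0 0 \<or> mass_tight a \<gamma> \<delta> f0 0"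
  proof (cases "\<delta> = 0")
    case True
    have "measure f0 (bad_interval a \<gamma> y) = \<delta>" if "y > 0" for y
    proof -
      have "measure f0 (bad_interval a \<gamma> y) \<le> \<delta>"
        using f0_feasible that by (simp add: feasible_def)
      then show ?thesis
        using True measure_nonneg[of f0 "bad_interval a \<gamma> y"] by linarith
    qed
    then have "\<forall>\<^sub>F y in at_right 0. measure f0 (bad_interval a \<gamma> y) = \<delta>"
      by (intro eventually_at_rightI[of 0 1]) auto
    then show ?thesis
      by (auto simp: mass_tight_def intro: tendsto_eventually)
  next
    case False
    then have "0 < \<delta>" using \<open>0 \<le> \<delta>\<close> by simp
    \<comment> \<open>Below \<open>b\<close>,
      \<open>M \<theta> r \<le> 4 * \<theta> * r < \<delta>\<close>, so the ratio equals
      \<open>OPT\<close> on a right neighbourhood of 0.\<close>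
    define b where "b = min 1 (\<delta> / (4 * \<theta>))"
    have b: "0 < b" "b \<le> 1"
      using \<theta> \<open>0 < \<delta>\<close> by (auto simp: b_def)
    have "expected_ratio a f0 y = OPT a \<gamma> \<delta>" if y: "y \<in> {0<..<ennreal b}" for y
    proof -
      obtain r where r: "y = ennreal r" "0 < r" "r < b"
        using y by (cases y) (auto simp: ennreal_less_iff)
      have "M \<theta> r \<le> \<theta> * r + integral {0..r} (M \<theta>)"
        using r b \<open>0 \<le> \<theta>\<close> by (intro M_integral) auto
      also have "\<dots> \<le> 4 * \<theta> * r"
        using integral_M_increment(1)[of \<theta> 0 r] r \<theta> by simp
      also have "\<dots> < \<delta>"
        using r(3) \<theta> by (simp add: b_def pos_less_divide_eq mult.commute)
      finally show ?thesis
        unfolding r(1) using r b by (intro CR_tight_if) auto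
    qed
    then have "\<forall>\<^sub>F y in at_right 0. expected_ratio a f0 y = OPT a \<gamma> \<delta>"
      using b by (intro eventually_at_rightI[of 0 "ennreal b"]) auto
    then show ?thesis
      by (auto simp: CR_tight_def intro: tendsto_eventually)
  qed
  have "CR_tight a \<gamma> \<delta> f0 x \<or> mass_tight a \<gamma> \<delta> f0 x" if x: "x \<in> {0..1}" for x
  proof (cases "x = 0")
    case False
    obtain r where "x = ennreal r" "0 < r" "r \<le> 1"
      using x False by (cases x) (auto simp: top_unique)
    then show ?thesis
      using tight by blast
  qed (use tight_0 in simp)
  moreover have "emeasure f0 {\<infinity>} > 0" if "0 < a"
    using f0.measure_infinity_eq(1)[OF f0(3)] M_at_1 \<theta>(1) that
    by (simp add: f0(2) f0.emeasure_eq_measure)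
  ultimately have "(\<forall>x\<in>{0..1}. CR_tight a \<gamma> \<delta> f0 x \<or> mass_tight a \<gamma> \<delta> f0 x) \<and>
      emeasure f0 {1<..<\<infinity>} = 0 \<and> (0 < a \<longrightarrow> emeasure f0 {\<infinity>} > 0)"
    using f0(3) by blast
  moreover have "\<exists>!f. optimal a \<gamma> \<delta> f"
    using f0_optimal optimal_eq by (rule ex1I)
  ultimately show ?thesis
    using optimal_eq by blast
qed

end
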